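(* Let $k$ be an algebraically closed field of arbitrary characteristic, let $n\ge 1$ and $d\ge 3$. Then every non-singular hypersurface $X\subset\mathbb{P}^n_k$ of degree $d$ is Chow stable.
   Context: For a hypersurface $X=V(F)\subset\mathbb{P}^n_k$ with $F\in k[X_0,\dots,X_n]$ a non-zero homogeneous polynomial of degree $d$, the Chow form of $X$ is $F$ itself. The canonical action of $SL(n+1,k)$ on $\mathbb{P}^n_k$ induces a linear action on the vector space $k[X_0,\dots,X_n]_d$ of degree $d$ forms. $X$ is called Chow stable if the point $[F]\in\mathbb{P}(k[X_0,\dots,X_n]_d)$ is GIT stable (in the sense of "properly stable") for this action: the $SL(n+1,k)$-orbit of $F$ is closed in $k[X_0,\dots,X_n]_d$ and the stabilizer of $F$ in $SL(n+1,k)$ is finite. $X=V(F)$ is non-singular if $F,\partial F/\partial X_0,\dots,\partial F/\partial X_n$ have no common zero in $\mathbb{P}^n_k$. *)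

theory Defs
  imports
    "HOL-Analysis.Determinants"
    "HOL-Library.Poly_Mapping"
    "HOL-Computational_Algebra.Polynomial"
begin

text \<open>
  A polynomial with coefficients in \<open>'a\<close> and variables indexed by \<open>'v\<close> is a finitely
  supported map from exponent vectors to coefficients; the ring structure (convolution
  product) is the one of \<^theory>\<open>HOL-Library.Poly_Mapping\<close>.
\<close>

type_synonym ('v, 'a) mpoly = "('v \<Rightarrow>\<^sub>0 nat) \<Rightarrow>\<^sub>0 'a"

definition mpoly_const :: "'a \<Rightarrow> ('v, 'a::comm_semiring_1) mpoly" where
  "mpoly_const c = Poly_Mapping.single 0 c"

definition mpoly_var :: "'v \<Rightarrow> ('v, 'a::comm_semiring_1) mpoly" where
  "mpoly_var i = Poly_Mapping.single (Poly_Mapping.single i 1) 1"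

definition mpoly_eval :: "('v \<Rightarrow> 'a) \<Rightarrow> ('v, 'a::comm_semiring_1) mpoly \<Rightarrow> 'a" where
  "mpoly_eval x F =
     (\<Sum>m\<in>Poly_Mapping.keys F. Poly_Mapping.lookup F m *
        (\<Prod>i\<in>Poly_Mapping.keys m. x i ^ Poly_Mapping.lookup m i))"

definition mpoly_subst ::
    "('v \<Rightarrow> ('w, 'a) mpoly) \<Rightarrow> ('v, 'a::comm_semiring_1) mpoly \<Rightarrow> ('w, 'a) mpoly" where
  "mpoly_subst L F =
     (\<Sum>m\<in>Poly_Mapping.keys F. mpoly_const (Poly_Mapping.lookup F m) *
        (\<Prod>i\<in>Poly_Mapping.keys m. L i ^ Poly_Mapping.lookup m i))"

text \<open>
  In the formal partial derivative, the truncated subtraction is harmless: if \<open>X\<^sub>i\<close> does not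
  occur in the monomial \<open>m\<close>, the coefficient is multiplied by \<open>0\<close>.
\<close>

definition mpoly_pderiv :: "'v \<Rightarrow> ('v, 'a::comm_semiring_1) mpoly \<Rightarrow> ('v, 'a) mpoly" where
  "mpoly_pderiv i F =
     (\<Sum>m\<in>Poly_Mapping.keys F. Poly_Mapping.single (m - Poly_Mapping.single i 1)
        (of_nat (Poly_Mapping.lookup m i) * Poly_Mapping.lookup F m))"

text \<open>
  The vector space \<open>k[X\<^sub>0,\<dots>,X\<^sub>n]\<^sub>d\<close>, zero included, with the \<open>n + 1\<close> variables indexed by
  a finite type \<open>'n\<close>.
\<close>

definition forms :: "nat \<Rightarrow> ('n::finite, 'a::comm_semiring_1) mpoly set" where
  "forms d = {F. \<forall>m\<in>Poly_Mapping.keys F. (\<Sum>i\<in>UNIV. Poly_Mapping.lookup m i) = d}"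

text \<open>
  Points of projective space are represented by their non-zero homogeneous coordinate vectors.
\<close>

definition nonsingular_hypersurface :: "('n::finite, 'a::field) mpoly \<Rightarrow> bool" where
  "nonsingular_hypersurface F \<longleftrightarrow>
     \<not> (\<exists>x :: 'a ^ 'n. x \<noteq> 0 \<and> mpoly_eval (($) x) F = 0 \<and>
          (\<forall>i. mpoly_eval (($) x) (mpoly_pderiv i F) = 0))"

definition special_linear :: "('a::field ^ 'n ^ 'n) set" where
  "special_linear = {A. det A = 1}"

text \<open>
  The left action \<open>(A \<cdot> F)(x) = F(A\<^sup>-\<^sup>1 x)\<close> induced by the action of matrices on column vectors.
\<close>

definition matrix_act ::
    "'a::field ^ 'n ^ 'n \<Rightarrow> ('n::finite, 'a) mpoly \<Rightarrow> ('n, 'a) mpoly" where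
  "matrix_act A F =
     mpoly_subst (\<lambda>i. \<Sum>j\<in>UNIV. mpoly_const (matrix_inv A $ i $ j) * mpoly_var j) F"

definition SL_orbit :: "('n::finite, 'a::field) mpoly \<Rightarrow> ('n, 'a) mpoly set" where
  "SL_orbit F = (\<lambda>A. matrix_act A F) ` special_linear"

definition SL_stabilizer :: "('n::finite, 'a::field) mpoly \<Rightarrow> ('a ^ 'n ^ 'n) set" where
  "SL_stabilizer F = {A \<in> special_linear. matrix_act A F = F}"

text \<open>
  Zariski closed subsets of \<open>forms d\<close>, an affine space whose coordinates are the coefficients.
  The equations are polynomials whose variables are indexed by monomials; the variables
  belonging to monomials of degree other than \<open>d\<close> take the value \<open>0\<close> on \<open>forms d\<close>.
\<close>

definition zariski_closed_in_forms ::
    "nat \<Rightarrow> ('n::finite, 'a::field) mpoly set \<Rightarrow> bool" where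
  "zariski_closed_in_forms d Z \<longleftrightarrow>
     (\<exists>S :: ('n \<Rightarrow>\<^sub>0 nat, 'a) mpoly set.
        Z = {G \<in> forms d. \<forall>P\<in>S. mpoly_eval (Poly_Mapping.lookup G) P = 0})"

text \<open>
  Chow stability of the hypersurface \<open>V(F)\<close> of degree \<open>d\<close>, whose Chow form is \<open>F\<close>; stability
  is meant in the sense of ``properly stable''.
\<close>

definition chow_stable :: "nat \<Rightarrow> ('n::finite, 'a::field) mpoly \<Rightarrow> bool" where
  "chow_stable d F \<longleftrightarrow>
     zariski_closed_in_forms d (SL_orbit F) \<and> finite (SL_stabilizer F)"

end

theory Submission
  imports Defs "HOL-Computational_Algebra.Formal_Laurent_Series"
begin

unbundle no Formal_Power_Series.fps_syntax

text \<open>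
  The orbit map \<open>A \<mapsto> F \<circ> A\<close> on \<open>SL\<close> is proper, by a valuative argument. Let \<open>V\<close> be a valuation ring
  of a field \<open>K \<supseteq> k\<close> with residue field \<open>k\<close>, and let \<open>A \<in> SL(K)\<close> be such that \<open>F \<circ> A\<close> has coefficients
  in \<open>V\<close>. Write \<open>A = P D Q\<close> with \<open>P, Q \<in> GL(V)\<close> and \<open>D\<close> diagonal. The reduction of \<open>F \<circ> P\<close> is again
  non-singular, so sufficiently many monomials occur in it, and integrality of \<open>F \<circ> P D\<close> forces the
  valuations of the entries of \<open>D\<close>, whose sum is \<open>0\<close>, to vanish. Hence \<open>A\<close> is integral.

  A form in the Zariski closure of the orbit is the specialization, at a place of an ultrapower
  \<open>K\<close> of \<open>k\<close>, of \<open>F \<circ> A\<close> for some \<open>A \<in> SL(K)\<close>; as \<open>A\<close> is integral, it specializes as well, and the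
  orbit is closed. If the stabilizer were infinite, it would have a point over \<open>K\<close> with an entry
  \<open>y \<notin> k\<close>, and a place with \<open>1 / y \<mapsto> 0\<close> would contradict integrality.
\<close>


subsection \<open>Evaluation of polynomials along a homomorphism\<close>

text \<open>The ultrapower supplies generic points: by saturation, one matrix over \<open>K\<close>
  avoids a whole family of conditions as soon as matrices over \<open>k\<close> avoid finitely many
  of them at a time. The price is a place whose value group is unknown and possibly not discrete;
  valuations are therefore only compared, through divisibility in \<open>V\<close>, and a sum of
  weights appears as a product of field elements. That a non-singular form contains enough monomials
  is a dimension count. Let \<open>F\<close> vanish on the coordinate subspace spanned by
  \<open>I\<close>. Its derivatives in the directions of \<open>I\<close> vanish there too, so the
  common zeros there of the other derivatives, which are forms of degree \<open>d - 1\<close>, are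
  singular points; fewer than \<open>card I\<close> non-zero ones would have such a zero. Value and
  derivatives are treated together, so the count is uniform in the characteristic. The bound
  \<open>d \<ge> 3\<close> enters as a positive exponent \<open>d - 2\<close>: the lower half of the
  weights has a sum whose \<open>(d - 2)\<close>-fold multiple is non-negative. For
  \<open>d = 2\<close> this says nothing, and indeed a torus stabilizes the quadric
  \<open>X Y\<close> on the projective line.\<close>

locale unital_hom =
  fixes h :: "'a::comm_semiring_1 \<Rightarrow> 'b::comm_semiring_1"
  assumes hom_zero: "h 0 = 0" and hom_one: "h 1 = 1"
    and hom_add: "h (a + b) = h a + h b" and hom_mult: "h (a * b) = h a * h b"
begin

lemma hom_sum: "h (sum f A) = (\<Sum>i\<in>A. h (f i))"
  by (induction A rule: infinite_finite_induct) (auto simp: hom_zero hom_add)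

lemma hom_prod: "h (prod f A) = (\<Prod>i\<in>A. h (f i))"
  by (induction A rule: infinite_finite_induct) (auto simp: hom_one hom_mult)

lemma hom_power: "h (a ^ n) = h a ^ n"
  by (induction n) (auto simp: hom_one hom_mult)

lemma map_poly_hom_add: "map_poly h (p + q) = map_poly h p + map_poly h q"
  by (rule poly_eqI) (simp add: coeff_map_poly hom_zero hom_add)

lemma map_poly_hom_mult: "map_poly h (p * q) = map_poly h p * map_poly h q"
  by (rule poly_eqI) (simp add: coeff_map_poly hom_zero coeff_mult hom_sum hom_mult)

lemma hom_of_nat: "h (of_nat n) = of_nat n"
  by (induction n) (auto simp: hom_zero hom_one hom_add)

end

lemma unital_hom_id: "unital_hom (\<lambda>x. x)"
  by unfold_locales auto

lemma unital_hom_compose: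
  assumes "unital_hom f" "unital_hom g"
  shows "unital_hom (\<lambda>x. g (f x))"
  using assms unfolding unital_hom_def by simp

definition monom_val :: "('v \<Rightarrow> 'b::comm_semiring_1) \<Rightarrow> ('v \<Rightarrow>\<^sub>0 nat) \<Rightarrow> 'b" where
  "monom_val x m = (\<Prod>i\<in>Poly_Mapping.keys m. x i ^ Poly_Mapping.lookup m i)"

text \<open>Evaluation and substitution are the cases \<open>h = (\<lambda>c. c)\<close> and
  \<open>h = mpoly_const\<close>, so the ring laws are proved once for both.\<close>

definition mpoly_hom ::
    "('a::comm_semiring_1 \<Rightarrow> 'b::comm_semiring_1) \<Rightarrow> ('v \<Rightarrow> 'b) \<Rightarrow> ('v, 'a) mpoly \<Rightarrow> 'b" where
  "mpoly_hom h x F = (\<Sum>m\<in>Poly_Mapping.keys F. h (Poly_Mapping.lookup F m) * monom_val x m)"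

lemma mpoly_eval_eq_hom: "mpoly_eval x = mpoly_hom (\<lambda>c. c) x"
  by (rule ext) (simp add: mpoly_eval_def mpoly_hom_def monom_val_def)

lemma mpoly_subst_eq_hom: "mpoly_subst L = mpoly_hom mpoly_const L"
  by (rule ext) (simp add: mpoly_subst_def mpoly_hom_def monom_val_def)

lemma monom_val_superset:
  assumes "finite A" "Poly_Mapping.keys m \<subseteq> A"
  shows "monom_val x m = (\<Prod>i\<in>A. x i ^ Poly_Mapping.lookup m i)"
  unfolding monom_val_def using assms
  by (intro prod.mono_neutral_left) (auto simp: in_keys_iff)

lemma monom_val_UNIV:
  fixes m :: "'n::finite \<Rightarrow>\<^sub>0 nat"
  shows "monom_val x m = (\<Prod>i\<in>UNIV. x i ^ Poly_Mapping.lookup m i)"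
  by (rule monom_val_superset) auto

lemma monom_val_zero [simp]: "monom_val x 0 = 1"
  by (simp add: monom_val_def)

lemma monom_val_single [simp]: "monom_val x (Poly_Mapping.single i k) = x i ^ k"
  by (simp add: monom_val_def)

lemma monom_val_add: "monom_val x (m + m') = monom_val x m * monom_val x m'"
proof -
  let ?A = "Poly_Mapping.keys m \<union> Poly_Mapping.keys m'"
  have "monom_val x (m + m') = (\<Prod>i\<in>?A. x i ^ Poly_Mapping.lookup (m + m') i)"
    by (rule monom_val_superset) (auto dest: subsetD[OF Poly_Mapping.keys_add])
  also have "\<dots> = monom_val x m * monom_val x m'"
    by (simp add: monom_val_superset[of ?A] lookup_add power_add prod.distrib)
  finally show ?thesis .
qed

lemma (in unital_hom) hom_monom_val: "h (monom_val x m) = monom_val (\<lambda>i. h (x i)) m"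
  by (simp add: monom_val_def hom_prod hom_power)

lemma sum_single: "F = (\<Sum>m\<in>Poly_Mapping.keys F. Poly_Mapping.single m (Poly_Mapping.lookup F m))"
proof (rule poly_mapping_eqI)
  fix m
  show "Poly_Mapping.lookup F m =
    Poly_Mapping.lookup (\<Sum>m\<in>Poly_Mapping.keys F. Poly_Mapping.single m (Poly_Mapping.lookup F m)) m"
    by (simp add: lookup_sum lookup_single when_def in_keys_iff)
qed

lemma mpoly_const_hom: "unital_hom (mpoly_const :: 'a::comm_semiring_1 \<Rightarrow> ('v, 'a) mpoly)"
  by unfold_locales (auto simp: mpoly_const_def single_add mult_single)

context unital_hom
begin

lemma mpoly_hom_superset:
  assumes "finite A" "Poly_Mapping.keys F \<subseteq> A"
  shows "mpoly_hom h x F = (\<Sum>m\<in>A. h (Poly_Mapping.lookup F m) * monom_val x m)"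
  unfolding mpoly_hom_def using assms
  by (intro sum.mono_neutral_left) (auto simp: in_keys_iff hom_zero)

lemma mpoly_hom_add: "mpoly_hom h x (F + G) = mpoly_hom h x F + mpoly_hom h x G"
proof -
  let ?A = "Poly_Mapping.keys F \<union> Poly_Mapping.keys G"
  have "mpoly_hom h x (F + G) = (\<Sum>m\<in>?A. h (Poly_Mapping.lookup (F + G) m) * monom_val x m)"
    by (rule mpoly_hom_superset) (auto dest: subsetD[OF Poly_Mapping.keys_add])
  also have "\<dots> = mpoly_hom h x F + mpoly_hom h x G"
    by (simp add: mpoly_hom_superset[of ?A] lookup_add hom_add sum.distrib algebra_simps)
  finally show ?thesis .
qed

lemma mpoly_hom_zero: "mpoly_hom h x 0 = 0"
  by (simp add: mpoly_hom_def)

lemma mpoly_hom_single: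
  "mpoly_hom h x (Poly_Mapping.single m c) = h c * monom_val x m"
  by (subst mpoly_hom_superset[of "{m}"]) auto

lemma mpoly_hom_sum: "mpoly_hom h x (sum f A) = (\<Sum>i\<in>A. mpoly_hom h x (f i))"
  by (induction A rule: infinite_finite_induct) (auto simp: mpoly_hom_zero mpoly_hom_add)

lemma mpoly_hom_mult: "mpoly_hom h x (F * G) = mpoly_hom h x F * mpoly_hom h x G"
proof -
  let ?s = "\<lambda>F m. Poly_Mapping.single m (Poly_Mapping.lookup F m)"
  have "F * G = (\<Sum>m\<in>Poly_Mapping.keys F. ?s F m) * (\<Sum>m\<in>Poly_Mapping.keys G. ?s G m)"
    by (simp flip: sum_single)
  also have "\<dots> = (\<Sum>m\<in>Poly_Mapping.keys F. \<Sum>m'\<in>Poly_Mapping.keys G.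
      Poly_Mapping.single (m + m') (Poly_Mapping.lookup F m * Poly_Mapping.lookup G m'))"
    by (simp add: sum_product mult_single)
  finally have "mpoly_hom h x (F * G) = (\<Sum>m\<in>Poly_Mapping.keys F. \<Sum>m'\<in>Poly_Mapping.keys G.
      (h (Poly_Mapping.lookup F m) * monom_val x m) * (h (Poly_Mapping.lookup G m') * monom_val x m'))"
    by (simp add: mpoly_hom_sum mpoly_hom_single monom_val_add hom_mult ac_simps)
  then show ?thesis
    by (simp add: mpoly_hom_def sum_product)
qed

lemma mpoly_hom_const: "mpoly_hom h x (mpoly_const c) = h c"
  by (simp add: mpoly_const_def mpoly_hom_single)

lemma mpoly_hom_var: "mpoly_hom h x (mpoly_var i) = x i"
  by (simp add: mpoly_var_def mpoly_hom_single hom_one)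

lemma unital_hom_mpoly_hom: "unital_hom (mpoly_hom h x)"
proof
  show "mpoly_hom h x 1 = 1"
    using mpoly_hom_single[of x 0 1] by (simp add: hom_one)
qed (auto simp: mpoly_hom_zero mpoly_hom_add mpoly_hom_mult)

lemma hom_mpoly_hom: "h (mpoly_hom f x F) = mpoly_hom (\<lambda>c. h (f c)) (\<lambda>i. h (x i)) F"
  by (simp add: mpoly_hom_def hom_sum hom_mult hom_monom_val)

text \<open>Changing the coefficients along \<open>h\<close> is written as a
  \<open>mpoly_hom\<close>, so that it composes with other substitutions by the general
  laws.\<close>

lemma mpoly_hom_map_coeffs:
  "Poly_Mapping.lookup (mpoly_hom (\<lambda>c. mpoly_const (h c)) mpoly_var F) m =
    h (Poly_Mapping.lookup F m)"
proof -
  interpret c: unital_hom "\<lambda>c. mpoly_const (h c)"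
    by (rule unital_hom_compose[OF _ mpoly_const_hom]) unfold_locales
  have var: "monom_val mpoly_var m' = Poly_Mapping.single m' (1::'b)" for m' :: "'c \<Rightarrow>\<^sub>0 nat"
  proof -
    have pw: "mpoly_var i ^ k = Poly_Mapping.single (Poly_Mapping.single i k) (1::'b)" for i :: 'c and k
      by (induction k) (auto simp: mpoly_var_def mult_single simp flip: single_add)
    have "(\<Prod>i\<in>A. Poly_Mapping.single (f i) (1::'b)) = Poly_Mapping.single (\<Sum>i\<in>A. f i) 1"
      for A :: "'c set" and f :: "'c \<Rightarrow> ('c \<Rightarrow>\<^sub>0 nat)"
      by (induction A rule: infinite_finite_induct) (auto simp: mult_single)
    then show ?thesis
      by (simp add: monom_val_def pw flip: sum_single)
  qed
  have "mpoly_hom (\<lambda>c. mpoly_const (h c)) mpoly_var F =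
      (\<Sum>m\<in>Poly_Mapping.keys F. Poly_Mapping.single m (h (Poly_Mapping.lookup F m)))"
    by (simp add: mpoly_hom_def var mpoly_const_def mult_single)
  then show ?thesis
    by (simp add: lookup_sum lookup_single when_def in_keys_iff hom_zero)
qed

end

subsection \<open>Linear substitutions\<close>

definition linear_forms :: "'b::comm_semiring_1 ^ 'n ^ 'n \<Rightarrow> 'n::finite \<Rightarrow> ('n, 'b) mpoly" where
  "linear_forms B i = (\<Sum>j\<in>UNIV. mpoly_const (B $ i $ j) * mpoly_var j)"

text \<open>Base change and substitution in one operation, because \<open>F\<close> lives over
  \<open>k\<close> while the matrices have entries in an extension field.\<close>

definition lin_subst ::
    "('a::comm_semiring_1 \<Rightarrow> 'b::comm_semiring_1) \<Rightarrow> 'b ^ 'n ^ 'n \<Rightarrow> ('n::finite, 'a) mpoly \<Rightarrow> ('n, 'b) mpoly" where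
  "lin_subst h B F = mpoly_hom (\<lambda>c. mpoly_const (h c)) (linear_forms B) F"

lemma matrix_act_eq: "matrix_act A F = lin_subst (\<lambda>c. c) (matrix_inv A) F"
  by (simp add: matrix_act_def lin_subst_def mpoly_subst_eq_hom linear_forms_def[abs_def])

context unital_hom
begin

lemma const_hom: "unital_hom (\<lambda>c. mpoly_const (h c))"
  by (rule unital_hom_compose[OF _ mpoly_const_hom]) unfold_locales

lemma mpoly_hom_linear_forms:
  "mpoly_hom h x (linear_forms B i) = (\<Sum>j\<in>UNIV. h (B $ i $ j) * x j)"
  by (simp add: linear_forms_def mpoly_hom_sum mpoly_hom_mult mpoly_hom_const mpoly_hom_var)

lemma mpoly_hom_lin_subst:
  "mpoly_hom h x (lin_subst f B F) =
    mpoly_hom (\<lambda>c. h (f c)) (\<lambda>i. \<Sum>j\<in>UNIV. h (B $ i $ j) * x j) F"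
proof -
  interpret e: unital_hom "mpoly_hom h x"
    by (rule unital_hom_mpoly_hom)
  show ?thesis
    by (simp add: lin_subst_def e.hom_mpoly_hom mpoly_hom_const mpoly_hom_linear_forms)
qed

lemma lin_subst_lin_subst:
  "lin_subst h C (lin_subst f B F) = lin_subst (\<lambda>c. h (f c)) ((\<chi> i j. h (B $ i $ j)) ** C) F"
proof -
  interpret c: unital_hom "\<lambda>c. mpoly_const (h c)"
    by (rule const_hom)
  interpret k: unital_hom "mpoly_const :: 'b \<Rightarrow> ('c, 'b) mpoly"
    by (rule mpoly_const_hom)
  have "(\<Sum>j\<in>UNIV. mpoly_const (h (B $ i $ j)) * linear_forms C j) =
      linear_forms ((\<chi> i j. h (B $ i $ j)) ** C) i" for i
    by (simp add: linear_forms_def matrix_matrix_mult_def sum_distrib_left sum_distrib_right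
          k.hom_sum k.hom_mult mult.assoc) (rule sum.swap)
  then show ?thesis
    by (simp add: lin_subst_def[of h] c.mpoly_hom_lin_subst) (simp add: lin_subst_def)
qed

end

text \<open>The coefficients of \<open>F(B x)\<close> as polynomials in the entries of \<open>B\<close>.\<close>

definition universal_coeff ::
    "('n::finite, 'a::comm_semiring_1) mpoly \<Rightarrow> ('n \<Rightarrow>\<^sub>0 nat) \<Rightarrow> ('n \<times> 'n, 'a) mpoly" where
  "universal_coeff F = Poly_Mapping.lookup (lin_subst mpoly_const (\<chi> i j. mpoly_var (i, j)) F)"

text \<open>The generic matrix specializes to \<open>B\<close> under evaluation of its entries. This
  polynomial dependence on \<open>B\<close> is what lets coefficients pass through residue maps and
  ultrapowers.\<close>

lemma (in unital_hom) lookup_lin_subst: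
  "Poly_Mapping.lookup (lin_subst h B F) m =
    mpoly_hom h (\<lambda>(i, j). B $ i $ j) (universal_coeff F m)"
proof -
  let ?x = "\<lambda>(i, j). B $ i $ j"
  interpret e: unital_hom "mpoly_hom h ?x"
    by (rule unital_hom_mpoly_hom)
  interpret c: unital_hom "\<lambda>c. mpoly_const (mpoly_hom h ?x c) :: ('c, 'b) mpoly"
    by (rule e.const_hom)
  have "mpoly_hom h ?x (universal_coeff F m) = Poly_Mapping.lookup
      (mpoly_hom (\<lambda>c. mpoly_const (mpoly_hom h ?x c)) mpoly_var
        (lin_subst mpoly_const (\<chi> i j. mpoly_var (i, j)) F)) m"
    by (simp add: universal_coeff_def e.mpoly_hom_map_coeffs)
  also have "\<dots> = Poly_Mapping.lookup (lin_subst h B F) m"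
    by (simp add: c.mpoly_hom_lin_subst mpoly_hom_const mpoly_hom_var)
      (simp add: lin_subst_def linear_forms_def[abs_def])
  finally show ?thesis ..
qed

section \<open>Degrees under ring operations and linear substitutions\<close>

lemma forms_0: "0 \<in> forms d"
  by (simp add: forms_def)

lemma forms_add: "F \<in> forms d \<Longrightarrow> G \<in> forms d \<Longrightarrow> F + G \<in> forms d"
  by (auto simp: forms_def dest!: subsetD[OF Poly_Mapping.keys_add])

lemma forms_sum: "(\<And>i. i \<in> A \<Longrightarrow> f i \<in> forms d) \<Longrightarrow> sum f A \<in> forms d"
  by (induction A rule: infinite_finite_induct) (auto simp: forms_0 forms_add)

lemma forms_mult: "F \<in> forms d \<Longrightarrow> G \<in> forms e \<Longrightarrow> F * G \<in> forms (d + e)"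
  by (auto simp: forms_def lookup_add sum.distrib dest!: subsetD[OF Poly_Mapping.keys_mult])

lemma forms_const: "mpoly_const c \<in> forms 0"
  by (simp add: forms_def mpoly_const_def)

lemma forms_1: "1 \<in> forms 0"
  by (simp add: forms_def)

lemma forms_var: "mpoly_var i \<in> forms 1"
  by (simp add: forms_def mpoly_var_def lookup_single when_def)

lemma forms_power: "F \<in> forms d \<Longrightarrow> F ^ k \<in> forms (k * d)"
  by (induction k) (auto simp: forms_1 intro!: forms_mult)

lemma forms_prod: "(\<And>i. i \<in> A \<Longrightarrow> f i \<in> forms (e i)) \<Longrightarrow> prod f A \<in> forms (sum e A)"
  by (induction A rule: infinite_finite_induct) (auto simp: forms_1 intro!: forms_mult)

lemma forms_lin_subst:
  assumes "F \<in> forms d"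
  shows "lin_subst h B F \<in> forms d"
proof -
  have lin: "linear_forms B i \<in> forms 1" for i
    unfolding linear_forms_def using forms_mult[OF forms_const forms_var] by (intro forms_sum) simp
  have "mpoly_const c * monom_val (linear_forms B) m \<in> forms d" if "m \<in> Poly_Mapping.keys F" for m c
  proof -
    have "monom_val (linear_forms B) m \<in> forms (\<Sum>i\<in>UNIV. Poly_Mapping.lookup m i * 1)"
      unfolding monom_val_UNIV by (intro forms_prod forms_power lin)
    then show ?thesis
      using that assms forms_mult[OF forms_const] by (fastforce simp: forms_def)
  qed
  then show ?thesis
    unfolding lin_subst_def mpoly_hom_def by (intro forms_sum)
qed


subsection \<open>Saturated ultrapowers of fields\<close>

text \<open>Zorn's lemma for the reversed order of filters: the infimum of a chain is proper, since
  an event holding eventually for it already does so for a member of the chain.\<close>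

lemma ultrafilter_below:
  fixes F :: "'i filter"
  assumes "F \<noteq> bot"
  shows "\<exists>U\<le>F. U \<noteq> bot \<and> (\<forall>P. eventually P U \<or> eventually (\<lambda>i. \<not> P i) U)"
proof -
  let ?A = "{G. G \<noteq> bot \<and> G \<le> F}"
  let ?r = "\<lambda>G H :: 'i filter. H \<le> G"
  have "\<exists>m\<in>?A. \<forall>a\<in>?A. ?r m a \<longrightarrow> a = m"
  proof (rule predicate_Zorn)
    show "partial_order_on ?A (relation_of ?r ?A)"
      by (rule partial_order_on_relation_ofI) auto
  next
    fix C assume C: "C \<in> Chains (relation_of ?r ?A)"
    show "\<exists>u\<in>?A. \<forall>a\<in>C. u \<le> a"
    proof (cases "C = {}")
      case True
      with assms show ?thesis by auto
    next
      case False
      have sub: "C \<subseteq> ?A"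
        using C by (auto simp: Chains_def relation_of_def)
      have lin: "G \<le> H \<or> H \<le> G" if "G \<in> C" "H \<in> C" for G H
        using C that by (auto simp: Chains_def relation_of_def)
      have "\<exists>x\<in>C. x \<le> inf G H" if "G \<in> C" "H \<in> C" for G H
        using lin[OF that] that by (metis inf.absorb1 inf.absorb2 order_refl)
      then have "eventually (\<lambda>_. False) (Inf C) \<longleftrightarrow> (\<exists>G\<in>C. eventually (\<lambda>_. False) G)"
        by (rule eventually_Inf_base[OF False])
      then have "Inf C \<noteq> bot"
        using sub unfolding trivial_limit_def by blast
      moreover have "Inf C \<le> F"
        using False sub by (auto intro: Inf_lower2)
      ultimately show ?thesis
        by (auto intro: Inf_lower)
    qed
  qed
  then obtain U where U: "U \<noteq> bot" "U \<le> F" and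
    min: "\<And>G. G \<noteq> bot \<Longrightarrow> G \<le> F \<Longrightarrow> G \<le> U \<Longrightarrow> G = U"
    by auto
  have "eventually P U \<or> eventually (\<lambda>i. \<not> P i) U" for P
  proof (rule disjCI)
    assume *: "\<not> eventually (\<lambda>i. \<not> P i) U"
    have "inf U (principal {i. P i}) \<noteq> bot"
      using * by (auto simp: trivial_limit_def eventually_inf_principal)
    then have "inf U (principal {i. P i}) = U"
      using U by (intro min) (auto intro: le_infI1)
    moreover have "eventually P (inf U (principal {i. P i}))"
      by (simp add: eventually_inf_principal)
    ultimately show "eventually P U" by simp
  qed
  with U show ?thesis by blast
qed

text \<open>An ultrafilter indexed so that every family of subsets of \<open>'x\<close> with the finite
  intersection property is realized by a point of the ultrapower of \<open>'x\<close>.\<close>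

definition saturating_ultrafilter :: "'x set set filter" where
  "saturating_ultrafilter = (SOME U. U \<le> finite_subsets_at_top UNIV \<and> U \<noteq> bot \<and>
     (\<forall>P. eventually P U \<or> eventually (\<lambda>i. \<not> P i) U))"

lemma saturating_ultrafilter:
  "(saturating_ultrafilter :: 'x set set filter) \<le> finite_subsets_at_top UNIV"
  "(saturating_ultrafilter :: 'x set set filter) \<noteq> bot"
  "eventually P (saturating_ultrafilter :: 'x set set filter) \<or>
    eventually (\<lambda>i. \<not> P i) (saturating_ultrafilter :: 'x set set filter)"
  using someI_ex[OF ultrafilter_below[of "finite_subsets_at_top (UNIV :: 'x set set)"]]
  unfolding saturating_ultrafilter_def[symmetric] by auto

text \<open>An index is itself a set of subsets of \<open>'x\<close>. At a finite index
  \<open>i\<close>, choose a point common to the members of \<open>i\<close> that belong to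
  \<open>\<E>\<close>; almost every index is finite and contains a given \<open>E\<close>.\<close>

lemma saturation:
  fixes \<E> :: "'x set set"
  assumes "\<And>\<D>. finite \<D> \<Longrightarrow> \<D> \<subseteq> \<E> \<Longrightarrow> \<Inter>\<D> \<noteq> {}"
  shows "\<exists>s :: 'x set set \<Rightarrow> 'x. \<forall>E\<in>\<E>. eventually (\<lambda>i. s i \<in> E) saturating_ultrafilter"
proof (intro exI ballI)
  fix E assume E: "E \<in> \<E>"
  have "eventually (\<lambda>i. finite i \<and> {E} \<subseteq> i) (finite_subsets_at_top UNIV)"
    unfolding eventually_finite_subsets_at_top by (intro exI[of _ "{E}"]) auto
  then have "eventually (\<lambda>i. finite i \<and> {E} \<subseteq> i) saturating_ultrafilter"
    using saturating_ultrafilter(1) by (rule filter_leD[rotated])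
  then show "eventually (\<lambda>i. (SOME x. x \<in> \<Inter>(i \<inter> \<E>)) \<in> E) saturating_ultrafilter"
  proof (rule eventually_mono)
    fix i assume "finite i \<and> {E} \<subseteq> i"
    moreover from this have "(SOME x. x \<in> \<Inter>(i \<inter> \<E>)) \<in> \<Inter>(i \<inter> \<E>)"
      by (intro some_in_eq[THEN iffD2] assms) auto
    ultimately show "(SOME x. x \<in> \<Inter>(i \<inter> \<E>)) \<in> E"
      using E by auto
  qed
qed

\<comment> \<open>The ultrapower as a field extension\<close>
quotient_type ('x, 'a) hyper = "'x set set \<Rightarrow> 'a" /
  "\<lambda>f g. eventually (\<lambda>i. f i = g i) (saturating_ultrafilter :: 'x set set filter)"
proof (rule equivpI)
  show "reflp (\<lambda>f g. eventually (\<lambda>i. f i = g i) (saturating_ultrafilter :: 'x set set filter))"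
    by (auto intro: reflpI)
  show "symp (\<lambda>f g. eventually (\<lambda>i. f i = g i) (saturating_ultrafilter :: 'x set set filter))"
    by (auto intro!: sympI elim: eventually_mono)
  show "transp (\<lambda>f g. eventually (\<lambda>i. f i = g i) (saturating_ultrafilter :: 'x set set filter))"
    by (auto intro!: transpI elim: eventually_elim2)
qed

instantiation hyper :: (type, field) "{zero, one, plus, minus, times, uminus, inverse}"
begin

lift_definition zero_hyper :: "('a, 'b) hyper" is "\<lambda>_. 0" .
lift_definition one_hyper :: "('a, 'b) hyper" is "\<lambda>_. 1" .
lift_definition plus_hyper :: "('a, 'b) hyper \<Rightarrow> ('a, 'b) hyper \<Rightarrow> ('a, 'b) hyper"
  is "\<lambda>f g i. f i + g i" by (auto elim: eventually_elim2)
lift_definition minus_hyper :: "('a, 'b) hyper \<Rightarrow> ('a, 'b) hyper \<Rightarrow> ('a, 'b) hyper"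
  is "\<lambda>f g i. f i - g i" by (auto elim: eventually_elim2)
lift_definition times_hyper :: "('a, 'b) hyper \<Rightarrow> ('a, 'b) hyper \<Rightarrow> ('a, 'b) hyper"
  is "\<lambda>f g i. f i * g i" by (auto elim: eventually_elim2)
lift_definition divide_hyper :: "('a, 'b) hyper \<Rightarrow> ('a, 'b) hyper \<Rightarrow> ('a, 'b) hyper"
  is "\<lambda>f g i. f i / g i" by (auto elim: eventually_elim2)
lift_definition uminus_hyper :: "('a, 'b) hyper \<Rightarrow> ('a, 'b) hyper"
  is "\<lambda>f i. - f i" by (auto elim: eventually_mono)
lift_definition inverse_hyper :: "('a, 'b) hyper \<Rightarrow> ('a, 'b) hyper"
  is "\<lambda>f i. inverse (f i)" by (auto elim: eventually_mono)

instance ..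

end

instance hyper :: (type, field) field
proof
  fix a b c :: "('a, 'b) hyper"
  show "a * b * c = a * (b * c)" by transfer (simp add: mult.assoc)
  show "a * b = b * a" by transfer (simp add: mult.commute)
  show "1 * a = a" by transfer simp
  show "a + b + c = a + (b + c)" by transfer (simp add: add.assoc)
  show "a + b = b + a" by transfer (simp add: add.commute)
  show "0 + a = a" by transfer simp
  show "- a + a = 0" by transfer simp
  show "a - b = a + - b" by transfer simp
  show "(a + b) * c = a * c + b * c" by transfer (simp add: algebra_simps)
  show "(0::('a, 'b) hyper) \<noteq> 1" by transfer (simp add: saturating_ultrafilter(2))
  show "a / b = a * inverse b" by transfer (simp add: divide_inverse)
  show "inverse (0::('a, 'b) hyper) = 0" by transfer simp
  show "inverse a * a = 1" if "a \<noteq> 0"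
    using that
  proof transfer
    fix f :: "'a set set \<Rightarrow> 'b"
    assume "\<not> eventually (\<lambda>i. f i = 0) saturating_ultrafilter"
    \<comment> \<open>The one field axiom that requires an ultrafilter: a function that is not
      almost everywhere zero is almost everywhere non-zero.\<close>
    then have "eventually (\<lambda>i. f i \<noteq> 0) saturating_ultrafilter"
      using saturating_ultrafilter(3) by blast
    then show "eventually (\<lambda>i. inverse (f i) * f i = 1) saturating_ultrafilter"
      by (rule eventually_mono) simp
  qed
qed

lemma abs_hyper_hom:
  fixes f g :: "'x set set \<Rightarrow> 'a::field"
  shows "abs_hyper (\<lambda>_. 0) = (0 :: ('x, 'a) hyper)"
    and "abs_hyper (\<lambda>_. 1) = (1 :: ('x, 'a) hyper)"
    and "abs_hyper (\<lambda>i. f i + g i) = abs_hyper f + abs_hyper g"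
    and "abs_hyper (\<lambda>i. f i * g i) = abs_hyper f * abs_hyper g"
    and "abs_hyper (\<lambda>i. - f i) = - abs_hyper f"
  by (rule zero_hyper.abs_eq[symmetric] one_hyper.abs_eq[symmetric] plus_hyper.abs_eq[symmetric]
      times_hyper.abs_eq[symmetric] uminus_hyper.abs_eq[symmetric])+

lemma unital_hom_abs_hyper_const: "unital_hom (\<lambda>c::'a::field. abs_hyper (\<lambda>_. c) :: ('x, 'a) hyper)"
  by unfold_locales (rule abs_hyper_hom)+

lemma abs_hyper_eq_iff:
  "abs_hyper f = (abs_hyper g :: ('x, 'a) hyper) \<longleftrightarrow>
    eventually (\<lambda>i. f i = g i) (saturating_ultrafilter :: 'x set set filter)"
  by (rule hyper.abs_eq_iff)

lemma abs_hyper_sum: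
  "abs_hyper (\<lambda>i. \<Sum>a\<in>A. f a i) = (\<Sum>a\<in>A. abs_hyper (f a) :: ('x, 'a::field) hyper)"
  by (induction A rule: infinite_finite_induct) (simp_all add: abs_hyper_hom(1,3))

lemma abs_hyper_prod:
  "abs_hyper (\<lambda>i. \<Prod>a\<in>A. f a i) = (\<Prod>a\<in>A. abs_hyper (f a) :: ('x, 'a::field) hyper)"
  by (induction A rule: infinite_finite_induct) (simp_all add: abs_hyper_hom(2,4))

lemma abs_hyper_power:
  "abs_hyper (\<lambda>i. f i ^ n) = (abs_hyper f ^ n :: ('x, 'a::field) hyper)"
  by (induction n) (simp_all add: abs_hyper_hom(2,4))

text \<open>The instance of the theorem of Los for polynomial terms.\<close>

lemma abs_hyper_mpoly_eval:
  "abs_hyper (\<lambda>i. mpoly_eval (\<lambda>v. x v i) P) =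
    mpoly_hom (\<lambda>c. abs_hyper (\<lambda>_. c) :: ('x, 'a::field) hyper) (\<lambda>v. abs_hyper (x v)) P"
  unfolding mpoly_eval_def mpoly_hom_def monom_val_def abs_hyper_sum abs_hyper_hom(4)
    abs_hyper_prod abs_hyper_power ..

lemma abs_hyper_of_int: "abs_hyper (\<lambda>_. of_int z) = (of_int z :: ('x, 'a::field) hyper)"
proof (induction z)
  case (nonneg n)
  show ?case
    using unital_hom.hom_of_nat[OF unital_hom_abs_hyper_const, of n] by simp
next
  case (neg n)
  show ?case
    using unital_hom.hom_of_nat[OF unital_hom_abs_hyper_const, of "Suc n"]
      abs_hyper_hom(5)[of "\<lambda>_. of_nat (Suc n)"]
    unfolding of_int_minus of_int_of_nat_eq by metis
qed

lemma abs_hyper_det: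
  fixes B :: "'x set set \<Rightarrow> 'a::field ^ 'n ^ 'n"
  shows "abs_hyper (\<lambda>i. det (B i)) = (det (\<chi> a b. abs_hyper (\<lambda>i. B i $ a $ b)) :: ('x, 'a) hyper)"
  unfolding det_def abs_hyper_sum abs_hyper_hom(4) abs_hyper_prod abs_hyper_of_int by simp


subsection \<open>Places\<close>

text \<open>\<open>V\<close> is the valuation ring and \<open>g\<close> the residue map, whose values outside \<open>V\<close> are irrelevant.\<close>

locale place = \<iota>: unital_hom \<iota>
  for \<iota> :: "'k::field \<Rightarrow> 'K::field" +
  fixes V :: "'K set" and g :: "'K \<Rightarrow> 'k"
  assumes const_V: "\<iota> c \<in> V" and g_const: "g (\<iota> c) = c"
    and V_add: "x \<in> V \<Longrightarrow> y \<in> V \<Longrightarrow> x + y \<in> V"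
    and V_mult: "x \<in> V \<Longrightarrow> y \<in> V \<Longrightarrow> x * y \<in> V"
    and g_add: "x \<in> V \<Longrightarrow> y \<in> V \<Longrightarrow> g (x + y) = g x + g y"
    and g_mult: "x \<in> V \<Longrightarrow> y \<in> V \<Longrightarrow> g (x * y) = g x * g y"
    and inverse_V: "x \<notin> V \<Longrightarrow> inverse x \<in> V \<and> g (inverse x) = 0"
begin

lemma V_0: "0 \<in> V" and V_1: "1 \<in> V" and g_0: "g 0 = 0" and g_1: "g 1 = 1"
  using const_V[of 0] const_V[of 1] g_const[of 0] g_const[of 1] \<iota>.hom_zero \<iota>.hom_one by auto

lemma V_uminus: "x \<in> V \<Longrightarrow> - x \<in> V"
proof -
  have "\<iota> (-1) = -1"
    using \<iota>.hom_add[of "-1" 1] by (simp add: \<iota>.hom_zero \<iota>.hom_one eq_neg_iff_add_eq_0)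
  then show "x \<in> V \<Longrightarrow> - x \<in> V"
    using V_mult[of "-1" x] const_V[of "-1"] by simp
qed

lemma g_uminus: "x \<in> V \<Longrightarrow> g (- x) = - g x"
  using g_add[of x "- x"] by (simp add: V_uminus g_0 eq_neg_iff_add_eq_0 add.commute)

lemma V_sum: "(\<And>i. i \<in> A \<Longrightarrow> f i \<in> V) \<Longrightarrow> sum f A \<in> V"
  by (induction A rule: infinite_finite_induct) (auto simp: V_0 V_add)

lemma V_prod: "(\<And>i. i \<in> A \<Longrightarrow> f i \<in> V) \<Longrightarrow> prod f A \<in> V"
  by (induction A rule: infinite_finite_induct) (auto simp: V_1 V_mult)

lemma V_power: "x \<in> V \<Longrightarrow> x ^ n \<in> V"
  by (induction n) (auto simp: V_1 V_mult)

lemma g_sum: "(\<And>i. i \<in> A \<Longrightarrow> f i \<in> V) \<Longrightarrow> g (sum f A) = (\<Sum>i\<in>A. g (f i))"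
  by (induction A rule: infinite_finite_induct) (auto simp: g_0 V_sum g_add)

lemma g_prod: "(\<And>i. i \<in> A \<Longrightarrow> f i \<in> V) \<Longrightarrow> g (prod f A) = (\<Prod>i\<in>A. g (f i))"
  by (induction A rule: infinite_finite_induct) (auto simp: g_1 V_prod g_mult)

lemma g_power: "x \<in> V \<Longrightarrow> g (x ^ n) = g x ^ n"
  by (induction n) (auto simp: g_1 V_power g_mult)

lemma V_inverse_unit: "g x \<noteq> 0 \<Longrightarrow> inverse x \<in> V"
  using inverse_V[of "inverse x"] by auto

text \<open>If \<open>x\<close> were outside \<open>V\<close>, its inverse would have residue 0, and
  \<open>x ^ n * inverse x ^ n = 1\<close> would reduce to \<open>0 = 1\<close>.\<close>

lemma V_power_D:
  assumes "x ^ n \<in> V" "n > 0"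
  shows "x \<in> V"
proof (rule ccontr)
  assume x: "x \<notin> V"
  then have i: "inverse x \<in> V" "g (inverse x) = 0" and "x \<noteq> 0"
    using inverse_V V_0 by auto
  then have "x ^ n * inverse x ^ n = 1"
    by (simp flip: power_mult_distrib)
  then have "g (x ^ n) * g (inverse x) ^ n = 1"
    using i assms by (metis g_mult V_power g_power g_1)
  with i assms show False
    by (simp add: power_0_left)
qed

lemma mpoly_hom_V: "(\<And>v. x v \<in> V) \<Longrightarrow> mpoly_hom \<iota> x P \<in> V"
  by (auto simp: mpoly_hom_def monom_val_def intro!: V_sum V_mult const_V V_prod V_power)

lemma g_mpoly_hom: "(\<And>v. x v \<in> V) \<Longrightarrow> g (mpoly_hom \<iota> x P) = mpoly_eval (\<lambda>v. g (x v)) P"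
  by (auto simp: mpoly_eval_eq_hom mpoly_hom_def monom_val_def g_sum g_mult g_const g_prod g_power
      V_sum V_mult const_V V_prod V_power)

lemma g_det:
  assumes "\<And>i j. A $ i $ j \<in> V"
  shows "det A \<in> V" "g (det A) = det (\<chi> i j. g (A $ i $ j))"
proof -
  have z: "of_int z \<in> V \<and> g (of_int z) = of_int z" for z
  proof (induction z)
    case (nonneg n)
    show ?case
      using const_V[of "of_nat n"] g_const[of "of_nat n"] by (simp add: \<iota>.hom_of_nat)
  next
    case (neg n)
    show ?case
      using const_V[of "of_nat (Suc n)"] g_const[of "of_nat (Suc n)"]
      by (simp add: \<iota>.hom_of_nat V_uminus g_uminus del: of_nat_Suc)
  qed
  show "det A \<in> V" "g (det A) = det (\<chi> i j. g (A $ i $ j))"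
    using z assms by (auto simp: det_def g_sum g_mult g_prod V_sum V_mult V_prod)
qed

text \<open>\<open>vle x y\<close> says that the valuation of \<open>x\<close> is at most the one of \<open>y\<close>.\<close>

definition vle :: "'K \<Rightarrow> 'K \<Rightarrow> bool" where
  "vle x y \<longleftrightarrow> (\<exists>c\<in>V. y = c * x)"

lemma vle_refl: "vle x x"
  using V_1 unfolding vle_def by (metis mult_1)

lemma vle_trans: "vle x y \<Longrightarrow> vle y z \<Longrightarrow> vle x z"
  unfolding vle_def by (metis V_mult mult.assoc)

lemma vle_total: "vle x y \<or> vle y x"
proof (cases "x = 0 \<or> y = 0")
  case True
  then show ?thesis using V_0 by (auto simp: vle_def)
next
  case False
  then have "x = x / y * y" "y = inverse (x / y) * x" by auto
  then show ?thesis
    unfolding vle_def using inverse_V by metis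
qed

lemma vle_divide: "x \<noteq> 0 \<Longrightarrow> vle x y \<longleftrightarrow> y / x \<in> V"
  by (auto simp: vle_def intro!: bexI[of _ "y / x"])

lemma ex_vle_least:
  assumes "finite A" "A \<noteq> {}"
  shows "\<exists>a\<in>A. \<forall>b\<in>A. vle (f a) (f b)"
  using assms
proof (induction A rule: finite_ne_induct)
  case (singleton x)
  then show ?case by (auto simp: vle_refl)
next
  case (insert x A)
  then show ?case by (metis vle_total vle_trans insert_iff vle_refl)
qed

end

text \<open>A partial homomorphism from a subring of \<open>'K\<close> to \<open>'k\<close> extending the inverse of \<open>\<iota>\<close>, given by
  its graph.\<close>

definition partial_hom :: "('k::field \<Rightarrow> 'K::field) \<Rightarrow> ('K \<times> 'k) set \<Rightarrow> bool" where
  "partial_hom \<iota> \<Gamma> \<longleftrightarrow>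
     (\<forall>c. (\<iota> c, c) \<in> \<Gamma>) \<and>
     (\<forall>x a y b. (x, a) \<in> \<Gamma> \<longrightarrow> (y, b) \<in> \<Gamma> \<longrightarrow> (x + y, a + b) \<in> \<Gamma> \<and> (x * y, a * b) \<in> \<Gamma>) \<and>
     (\<forall>a. (0, a) \<in> \<Gamma> \<longrightarrow> a = 0)"

lemma partial_homD:
  assumes "partial_hom \<iota> \<Gamma>"
  shows "(\<iota> c, c) \<in> \<Gamma>"
    "(x, a) \<in> \<Gamma> \<Longrightarrow> (y, b) \<in> \<Gamma> \<Longrightarrow> (x + y, a + b) \<in> \<Gamma>"
    "(x, a) \<in> \<Gamma> \<Longrightarrow> (y, b) \<in> \<Gamma> \<Longrightarrow> (x * y, a * b) \<in> \<Gamma>"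
    "(0, a) \<in> \<Gamma> \<Longrightarrow> a = 0"
  using assms unfolding partial_hom_def by blast+

text \<open>Zorn's lemma applies to graphs directly: each closure condition involves at most two
  pairs, which lie in a common member of a chain.\<close>

lemma maximal_partial_hom:
  assumes "partial_hom \<iota> \<Gamma>0"
  obtains \<Gamma> where "\<Gamma>0 \<subseteq> \<Gamma>" "partial_hom \<iota> \<Gamma>"
    "\<And>\<Delta>. partial_hom \<iota> \<Delta> \<Longrightarrow> \<Gamma> \<subseteq> \<Delta> \<Longrightarrow> \<Delta> = \<Gamma>"
proof -
  let ?A = "{\<Gamma>. partial_hom \<iota> \<Gamma> \<and> \<Gamma>0 \<subseteq> \<Gamma>}"
  have "\<exists>M\<in>?A. \<forall>X\<in>?A. M \<subseteq> X \<longrightarrow> X = M"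
  proof (rule subset_Zorn_nonempty)
    show "?A \<noteq> {}" using assms by auto
  next
    fix C assume ne: "C \<noteq> {}" and C: "subset.chain ?A C"
    have sub: "C \<subseteq> ?A" and lin: "\<And>X Y. X \<in> C \<Longrightarrow> Y \<in> C \<Longrightarrow> X \<subseteq> Y \<or> Y \<subseteq> X"
      using C by (auto simp: subset_chain_def)
    have "partial_hom \<iota> (\<Union>C)"
      unfolding partial_hom_def
    proof (intro conjI allI impI)
      fix c show "(\<iota> c, c) \<in> \<Union>C"
        using ne sub partial_homD(1) by blast
    next
      fix a assume "(0, a) \<in> \<Union>C"
      then show "a = 0" using sub partial_homD(4) by blast
    next
      fix x a y b assume "(x, a) \<in> \<Union>C" "(y, b) \<in> \<Union>C"
      then obtain X Y where "X \<in> C" "Y \<in> C" "(x, a) \<in> X" "(y, b) \<in> Y" by blast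
      then obtain Z where Z: "Z \<in> C" "(x, a) \<in> Z" "(y, b) \<in> Z"
        using lin by blast
      then have "partial_hom \<iota> Z" using sub by blast
      with Z show "(x + y, a + b) \<in> \<Union>C" "(x * y, a * b) \<in> \<Union>C"
        using partial_homD(2,3) by blast+
    qed
    then show "\<Union>C \<in> ?A" using ne sub by auto
  qed
  then show ?thesis using that by (metis (mono_tags, lifting) mem_Collect_eq order.trans)
qed


section \<open>Chevalley's extension theorem: a maximal partial homomorphism is a place\<close>

context
  fixes \<iota> :: "'k::alg_closed_field \<Rightarrow> 'K::field" and \<Gamma> :: "('K \<times> 'k) set"
  assumes \<iota>: "unital_hom \<iota>" and \<Gamma>: "partial_hom \<iota> \<Gamma>"
    and maximal: "\<And>\<Delta>. partial_hom \<iota> \<Delta> \<Longrightarrow> \<Gamma> \<subseteq> \<Delta> \<Longrightarrow> \<Delta> = \<Gamma>"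
begin

interpretation \<iota>: unital_hom \<iota> by (rule \<iota>)

lemmas \<Gamma>_const = partial_homD(1)[OF \<Gamma>] and \<Gamma>_add = partial_homD(2)[OF \<Gamma>]
  and \<Gamma>_mult = partial_homD(3)[OF \<Gamma>] and \<Gamma>_zero = partial_homD(4)[OF \<Gamma>]

lemma \<Gamma>_0: "(0, 0) \<in> \<Gamma>" and \<Gamma>_1: "(1, 1) \<in> \<Gamma>"
  using \<Gamma>_const[of 0] \<Gamma>_const[of 1] by (simp_all add: \<iota>.hom_zero \<iota>.hom_one)

lemma \<Gamma>_uminus: "(x, a) \<in> \<Gamma> \<Longrightarrow> (- x, - a) \<in> \<Gamma>"
proof -
  have "\<iota> (-1) = -1"
    using \<iota>.hom_add[of "-1" 1] by (simp add: \<iota>.hom_zero \<iota>.hom_one eq_neg_iff_add_eq_0)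
  then show "(x, a) \<in> \<Gamma> \<Longrightarrow> (- x, - a) \<in> \<Gamma>"
    using \<Gamma>_mult[OF \<Gamma>_const[of "-1"], of x a] by simp
qed

lemma \<Gamma>_diff: "(x, a) \<in> \<Gamma> \<Longrightarrow> (y, b) \<in> \<Gamma> \<Longrightarrow> (x - y, a - b) \<in> \<Gamma>"
  using \<Gamma>_add[OF _ \<Gamma>_uminus, of x a y b] by simp

text \<open>Subtraction reduces single-valuedness to the value at 0, which is why
  \<open>partial_hom\<close> asks for nothing more.\<close>

lemma \<Gamma>_unique: "(x, a) \<in> \<Gamma> \<Longrightarrow> (x, b) \<in> \<Gamma> \<Longrightarrow> a = b"
  using \<Gamma>_diff[of x a x b] \<Gamma>_zero by fastforce

lemma \<Gamma>_sum: "(\<And>i. i \<in> A \<Longrightarrow> (f i, f' i) \<in> \<Gamma>) \<Longrightarrow> (sum f A, sum f' A) \<in> \<Gamma>"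
  by (induction A rule: infinite_finite_induct) (auto simp: \<Gamma>_0 \<Gamma>_add)

lemma \<Gamma>_power: "(x, a) \<in> \<Gamma> \<Longrightarrow> (x ^ n, a ^ n) \<in> \<Gamma>"
  by (induction n) (auto simp: \<Gamma>_1 \<Gamma>_mult)

text \<open>The homomorphism extends to the localization of its domain at \<open>x\<close>, and
  maximality forces this to be no extension. Thus the domain is a local ring.\<close>

lemma \<Gamma>_inverse:
  assumes xa: "(x, a) \<in> \<Gamma>" and "a \<noteq> 0"
  shows "(inverse x, inverse a) \<in> \<Gamma>"
proof -
  have "x \<noteq> 0" using assms \<Gamma>_zero by auto
  define \<Delta> where "\<Delta> = {(u / x ^ n, b / a ^ n) | u b n. (u, b) \<in> \<Gamma>}"
  have \<Delta>I: "(u / x ^ n, b / a ^ n) \<in> \<Delta>" if "(u, b) \<in> \<Gamma>" for u b n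
    using that unfolding \<Delta>_def by auto
  have sub: "\<Gamma> \<subseteq> \<Delta>"
    using \<Delta>I[where n = 0] by auto
  have "partial_hom \<iota> \<Delta>"
    unfolding partial_hom_def
  proof (intro conjI allI impI)
    show "(\<iota> c, c) \<in> \<Delta>" for c using sub \<Gamma>_const by auto
  next
    fix c assume "(0, c) \<in> \<Delta>"
    then show "c = 0" using \<open>x \<noteq> 0\<close> \<Gamma>_zero by (auto simp: \<Delta>_def)
  next
    fix y b z c assume "(y, b) \<in> \<Delta>" "(z, c) \<in> \<Delta>"
    then obtain u u' v v' n m where
      uv: "(u, u') \<in> \<Gamma>" "(v, v') \<in> \<Gamma>" "y = u / x ^ n" "b = u' / a ^ n" "z = v / x ^ m" "c = v' / a ^ m"
      unfolding \<Delta>_def by blast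
    have "y + z = (u * x ^ m + v * x ^ n) / x ^ (n + m)" "b + c = (u' * a ^ m + v' * a ^ n) / a ^ (n + m)"
      "y * z = (u * v) / x ^ (n + m)" "b * c = (u' * v') / a ^ (n + m)"
      using \<open>x \<noteq> 0\<close> \<open>a \<noteq> 0\<close> unfolding uv(3-6) by (simp_all add: divide_simps power_add)
    then show "(y + z, b + c) \<in> \<Delta>" "(y * z, b * c) \<in> \<Delta>"
      using \<Delta>I \<Gamma>_add \<Gamma>_mult \<Gamma>_power[OF xa] uv(1,2) by presburger+
  qed
  from maximal[OF this sub] \<Delta>I[OF \<Gamma>_1, of 1] show ?thesis
    by (simp add: divide_inverse)
qed

text \<open>The polynomial \<open>q\<close> is the reduction of \<open>p\<close>. In particular
  \<open>\<Gamma>_coeffs p 0\<close> says that all coefficients of \<open>p\<close> lie in the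
  maximal ideal.\<close>

definition \<Gamma>_coeffs :: "'K poly \<Rightarrow> 'k poly \<Rightarrow> bool" where
  "\<Gamma>_coeffs p q \<longleftrightarrow> (\<forall>i. (coeff p i, coeff q i) \<in> \<Gamma>)"

lemma \<Gamma>_coeffs_add: "\<Gamma>_coeffs p q \<Longrightarrow> \<Gamma>_coeffs p' q' \<Longrightarrow> \<Gamma>_coeffs (p + p') (q + q')"
  by (auto simp: \<Gamma>_coeffs_def \<Gamma>_add)

lemma \<Gamma>_coeffs_diff: "\<Gamma>_coeffs p q \<Longrightarrow> \<Gamma>_coeffs p' q' \<Longrightarrow> \<Gamma>_coeffs (p - p') (q - q')"
  by (auto simp: \<Gamma>_coeffs_def \<Gamma>_diff)

lemma \<Gamma>_coeffs_mult: "\<Gamma>_coeffs p q \<Longrightarrow> \<Gamma>_coeffs p' q' \<Longrightarrow> \<Gamma>_coeffs (p * p') (q * q')"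
  by (auto simp: \<Gamma>_coeffs_def coeff_mult intro!: \<Gamma>_sum \<Gamma>_mult)

lemma \<Gamma>_coeffs_pCons: "(u, a) \<in> \<Gamma> \<Longrightarrow> \<Gamma>_coeffs p q \<Longrightarrow> \<Gamma>_coeffs (pCons u p) (pCons a q)"
  by (auto simp: \<Gamma>_coeffs_def coeff_pCons split: nat.split)

lemma \<Gamma>_coeffs_0: "\<Gamma>_coeffs 0 0"
  by (simp add: \<Gamma>_coeffs_def \<Gamma>_0)

lemma \<Gamma>_coeffs_lift: "\<exists>p. \<Gamma>_coeffs p q"
proof
  show "\<Gamma>_coeffs (map_poly \<iota> q) q"
    by (simp add: \<Gamma>_coeffs_def coeff_map_poly \<iota>.hom_zero \<Gamma>_const)
qed

text \<open>The reductions of the polynomial relations of \<open>x\<close> over the domain form an ideal of \<open>k[T]\<close>. If it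
  is proper, it has a common root \<open>y\<close>, and the homomorphism extends by \<open>x \<mapsto> y\<close>.\<close>

lemma adjoin_or_unit_ideal:
  "(\<exists>y. (x, y) \<in> \<Gamma>) \<or> (\<exists>p. \<Gamma>_coeffs p 0 \<and> poly p x = 1)"
proof -
  define J where "J = {q. \<exists>p. \<Gamma>_coeffs p q \<and> poly p x = 0}"
  have J_mult: "r * q \<in> J" if "q \<in> J" for q r
    using that \<Gamma>_coeffs_lift[of r] \<Gamma>_coeffs_mult unfolding J_def by fastforce
  have J_diff: "q - r \<in> J" if "q \<in> J" "r \<in> J" for q r
    using that \<Gamma>_coeffs_diff unfolding J_def by fastforce
  show ?thesis
  proof (cases "1 \<in> J")
    case True
    then obtain p where p: "\<Gamma>_coeffs p 1" "poly p x = 0" by (auto simp: J_def)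
    have "\<Gamma>_coeffs 1 1"
      using \<Gamma>_coeffs_pCons[OF \<Gamma>_1 \<Gamma>_coeffs_0] by (simp add: one_pCons)
    \<comment> \<open>A relation \<open>p\<close> of \<open>x\<close> reducing to 1 yields
      \<open>1 - p\<close>, which has value 1 at \<open>x\<close> and reduces to 0.\<close>
    from \<Gamma>_coeffs_diff[OF this p(1)] p(2) show ?thesis
      by (intro disjI2 exI[of _ "1 - p"]) simp
  next
    case False
    have "\<exists>y. \<forall>q\<in>J. poly q y = 0"
    proof (cases "J \<subseteq> {0}")
      case True
      then show ?thesis by (metis poly_0 singletonD subsetD)
    next
      case nz: False
      \<comment> \<open>An element of least degree generates the ideal. Being no unit, it has a root
        because \<open>k\<close> is algebraically closed.\<close>
      then obtain q0 where "q0 \<in> J \<and> q0 \<noteq> 0" by blast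
      from ex_has_least_nat[of "\<lambda>q. q \<in> J \<and> q \<noteq> 0", OF this, of degree]
      have "\<exists>b. (b \<in> J \<and> b \<noteq> 0) \<and> (\<forall>q. q \<in> J \<and> q \<noteq> 0 \<longrightarrow> degree b \<le> degree q)" .
      then obtain b where b: "b \<in> J" "b \<noteq> 0"
        and min: "\<And>q. q \<in> J \<Longrightarrow> q \<noteq> 0 \<Longrightarrow> degree b \<le> degree q"
        by (elim exE conjE) simp
      have "degree b \<noteq> 0"
      proof
        assume "degree b = 0"
        then obtain c where c: "b = [:c:]" by (rule degree_eq_zeroE)
        with b(2) have "[:inverse c:] * b = 1" by (simp add: one_pCons)
        with J_mult[OF b(1)] False show False by metis
      qed
      then obtain y where y: "poly b y = 0"
        using alg_closed_imp_poly_has_root[of b] by auto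
      have "poly q y = 0" if "q \<in> J" for q
      proof -
        have "q mod b \<in> J"
          using J_diff[OF that J_mult[OF b(1)], of "q div b"] by (simp add: minus_div_mult_eq_mod)
        then have "q mod b = 0"
          using min[of "q mod b"] degree_mod_less[OF b(2), of q] by linarith
        then show ?thesis
          using y by (metis div_mult_mod_eq add.right_neutral poly_mult mult_zero_right)
      qed
      then show ?thesis by blast
    qed
    then obtain y where y: "\<And>q. q \<in> J \<Longrightarrow> poly q y = 0" by blast
    define \<Delta> where "\<Delta> = {(poly p x, poly q y) | p q. \<Gamma>_coeffs p q}"
    have \<Delta>I: "(poly p x, poly q y) \<in> \<Delta>" if "\<Gamma>_coeffs p q" for p q
      using that by (auto simp: \<Delta>_def)
    have sub: "\<Gamma> \<subseteq> \<Delta>"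
      using \<Delta>I[OF \<Gamma>_coeffs_pCons[OF _ \<Gamma>_coeffs_0]] by auto
    have "partial_hom \<iota> \<Delta>"
      unfolding partial_hom_def
    proof (intro conjI allI impI)
      show "(\<iota> c, c) \<in> \<Delta>" for c using sub \<Gamma>_const by auto
    next
      fix c assume "(0, c) \<in> \<Delta>"
      then obtain p q where "\<Gamma>_coeffs p q" "poly p x = 0" "c = poly q y"
        by (auto simp: \<Delta>_def)
      then show "c = 0" using y[of q] by (auto simp: J_def)
    next
      fix u b v c assume "(u, b) \<in> \<Delta>" "(v, c) \<in> \<Delta>"
      then obtain p q p' q' where pq: "\<Gamma>_coeffs p q" "\<Gamma>_coeffs p' q'"
        and uv: "u = poly p x" "b = poly q y" "v = poly p' x" "c = poly q' y"
        unfolding \<Delta>_def by blast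
      show "(u + v, b + c) \<in> \<Delta>" "(u * v, b * c) \<in> \<Delta>"
        unfolding uv
        using \<Delta>I[OF \<Gamma>_coeffs_add[OF pq]] \<Delta>I[OF \<Gamma>_coeffs_mult[OF pq]] by simp_all
    qed
    from maximal[OF this sub] \<Delta>I[OF \<Gamma>_coeffs_pCons[OF \<Gamma>_0 \<Gamma>_coeffs_pCons[OF \<Gamma>_1 \<Gamma>_coeffs_0]]]
    show ?thesis by auto
  qed
qed

text \<open>The element 1 lies in the ideal generated by the maximal ideal in the ring obtained by
  adjoining \<open>x\<close>; the bound \<open>n\<close> on the degree is the quantity for the
  descent.\<close>

definition unit_relation :: "'K \<Rightarrow> nat \<Rightarrow> bool" where
  "unit_relation x n \<longleftrightarrow> (\<exists>p. \<Gamma>_coeffs p 0 \<and> poly p x = 1 \<and> degree p \<le> n)"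

text \<open>The classical descent: the constant term of \<open>q\<close> is in the maximal ideal, so
  \<open>1 - coeff q 0\<close> is a unit. The relation for \<open>inverse x\<close> then expresses
  \<open>x ^ n\<close> through lower powers of \<open>x\<close> with coefficients in the maximal
  ideal, and this replaces the leading term of \<open>p\<close>.\<close>

lemma unit_relation_reduce:
  assumes x: "x \<noteq> 0" and "unit_relation x n" "unit_relation (inverse x) m" "m \<le> n"
  shows "n > 0 \<and> unit_relation x (n - 1)"
proof -
  from assms obtain p q where p: "\<Gamma>_coeffs p 0" "poly p x = 1" "degree p \<le> n"
    and q: "\<Gamma>_coeffs q 0" "poly q (inverse x) = 1" "degree q \<le> m"
    by (auto simp: unit_relation_def)
  have p\<Gamma>: "(coeff p i, 0) \<in> \<Gamma>" and q\<Gamma>: "(coeff q i, 0) \<in> \<Gamma>" for i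
    using p q by (auto simp: \<Gamma>_coeffs_def)
  have "n > 0"
  proof (rule ccontr)
    assume "\<not> n > 0"
    then have "coeff p 0 = 1"
      using p by (simp add: poly_altdef)
    then show False
      using p\<Gamma>[of 0] \<Gamma>_unique \<Gamma>_1 by fastforce
  qed
  define v where "v = inverse (1 - coeff q 0)"
  have 1: "(1 - coeff q 0, 1) \<in> \<Gamma>"
    using \<Gamma>_diff[OF \<Gamma>_1 q\<Gamma>] by simp
  then have nz: "1 - coeff q 0 \<noteq> 0"
    using \<Gamma>_zero by force
  have v: "(v, 1) \<in> \<Gamma>"
    using \<Gamma>_inverse[OF 1] by (simp add: v_def)
  \<comment> \<open>The non-constant part of the relation \<open>q\<close>, multiplied by
    \<open>x ^ n\<close>; the exponents \<open>n - i\<close> are not truncated because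
    \<open>m \<le> n\<close>, and they stay below \<open>n\<close> because the sum starts at
    1.\<close>
  define r where "r = (\<Sum>i = 1..m. monom (coeff q i) (n - i))"
  have "poly r x = x ^ n * (\<Sum>i = 1..m. coeff q i * inverse x ^ i)"
    unfolding r_def sum_distrib_left poly_sum poly_monom
  proof (rule sum.cong)
    fix i assume "i \<in> {1..m}"
    then have "x ^ n = x ^ (n - i) * x ^ i"
      using \<open>m \<le> n\<close> by (simp flip: power_add)
    then show "coeff q i * x ^ (n - i) = x ^ n * (coeff q i * inverse x ^ i)"
      using x by (simp add: power_inverse)
  qed simp
  also have "(\<Sum>i = 1..m. coeff q i * inverse x ^ i) = 1 - coeff q 0"
  proof -
    have "1 = (\<Sum>i\<le>m. coeff q i * inverse x ^ i)"
      unfolding q(2)[symmetric] poly_altdef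
      using q(3) by (intro sum.mono_neutral_left) (auto simp: coeff_eq_0)
    also have "\<dots> = coeff q 0 + (\<Sum>i = 1..m. coeff q i * inverse x ^ i)"
      by (simp add: atMost_atLeast0 sum.atLeast_Suc_atMost)
    finally show ?thesis by (simp only: eq_diff_eq add.commute)
  qed
  finally have r: "x ^ n = v * poly r x"
    using nz by (simp add: v_def)
  have r\<Gamma>: "(coeff r i, 0) \<in> \<Gamma>" for i
  proof -
    have "(\<Sum>j = 1..m. coeff (monom (coeff q j) (n - j)) i, \<Sum>j = 1..m. 0) \<in> \<Gamma>"
      by (rule \<Gamma>_sum) (simp add: q\<Gamma> \<Gamma>_0)
    then show ?thesis by (simp add: r_def coeff_sum)
  qed
  define p' where "p' = p - monom (coeff p n) n + smult (coeff p n * v) r"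
  have "(coeff p' i, 0) \<in> \<Gamma>" for i
  proof -
    have "(coeff p n * v * coeff r i, 0 * 1 * 0) \<in> \<Gamma>"
      by (intro \<Gamma>_mult p\<Gamma> v r\<Gamma>)
    moreover have "(coeff p i - coeff (monom (coeff p n) n) i, 0 - 0) \<in> \<Gamma>"
      by (intro \<Gamma>_diff p\<Gamma>) (simp add: p\<Gamma> \<Gamma>_0)
    ultimately show ?thesis
      using \<Gamma>_add[of _ 0 _ 0] by (simp add: p'_def)
  qed
  moreover have "poly p' x = 1"
    using p r by (simp add: p'_def poly_monom)
  moreover have "degree p' \<le> n - 1"
  proof -
    have "coeff r i = 0" if "i \<ge> n" for i
      using that \<open>n > 0\<close> by (auto simp: r_def coeff_sum intro!: sum.neutral)
    then show ?thesis
      using p(3) \<open>n > 0\<close> by (intro degree_le) (auto simp: p'_def coeff_eq_0)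
  qed
  ultimately show ?thesis
    using \<open>n > 0\<close> by (auto simp: unit_relation_def \<Gamma>_coeffs_def)
qed

lemma not_both_unit_relation:
  assumes "x \<noteq> 0" "unit_relation x n" "unit_relation (inverse x) m"
  shows False
  using assms
proof (induction "n + m" arbitrary: n m rule: less_induct)
  case less
  show ?case
  proof (cases "m \<le> n")
    case True
    with unit_relation_reduce[OF less.prems(1,2,3)] less show ?thesis
      by (metis add_less_cancel_right diff_less zero_less_one)
  next
    case False
    then have "m > 0 \<and> unit_relation (inverse x) (m - 1)"
      using unit_relation_reduce[of "inverse x" m n] less.prems by simp
    with less show ?thesis
      by (metis add_less_cancel_left diff_less zero_less_one)
  qed
qed

lemma domain_or_inverse: "(\<exists>y. (x, y) \<in> \<Gamma>) \<or> (inverse x, 0) \<in> \<Gamma>"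
proof (rule disjCI)
  assume "(inverse x, 0) \<notin> \<Gamma>"
  show "\<exists>y. (x, y) \<in> \<Gamma>"
  proof (cases "x = 0 \<or> (\<exists>y. (inverse x, y) \<in> \<Gamma>)")
    case True
    then show ?thesis
      using \<open>(inverse x, 0) \<notin> \<Gamma>\<close> \<Gamma>_0 \<Gamma>_inverse by (metis inverse_inverse_eq)
  next
    case False
    then show ?thesis
      using adjoin_or_unit_ideal[of x] adjoin_or_unit_ideal[of "inverse x"]
        not_both_unit_relation[of x] unfolding unit_relation_def by blast
  qed
qed

lemma place_maximal: "place \<iota> {x. \<exists>a. (x, a) \<in> \<Gamma>} (\<lambda>x. THE a. (x, a) \<in> \<Gamma>)"
proof -
  have the: "(THE a. (x, a) \<in> \<Gamma>) = a" if "(x, a) \<in> \<Gamma>" for x a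
    using that \<Gamma>_unique by blast
  show ?thesis
  proof unfold_locales
    fix x assume "x \<notin> {x. \<exists>a. (x, a) \<in> \<Gamma>}"
    then have "(inverse x, 0) \<in> \<Gamma>"
      using domain_or_inverse by auto
    then show "inverse x \<in> {x. \<exists>a. (x, a) \<in> \<Gamma>} \<and> (THE a. (inverse x, a) \<in> \<Gamma>) = 0"
      using the by auto
  qed (auto simp: the[OF \<Gamma>_const] the[OF \<Gamma>_add] the[OF \<Gamma>_mult] the intro: \<Gamma>_const \<Gamma>_add \<Gamma>_mult)
qed

end

text \<open>The residue field stays \<open>k\<close>, since each adjunction only asks for a root in
  \<open>k\<close> of a proper ideal of \<open>k[T]\<close>.\<close>

theorem place_extending_partial_hom:
  fixes \<iota> :: "'k::alg_closed_field \<Rightarrow> 'K::field"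
  assumes "unital_hom \<iota>" "partial_hom \<iota> \<Gamma>0"
  obtains V g where "place \<iota> V g" "\<And>x a. (x, a) \<in> \<Gamma>0 \<Longrightarrow> x \<in> V \<and> g x = a"
proof -
  obtain \<Gamma> where \<Gamma>: "\<Gamma>0 \<subseteq> \<Gamma>" "partial_hom \<iota> \<Gamma>"
    "\<And>\<Delta>. partial_hom \<iota> \<Delta> \<Longrightarrow> \<Gamma> \<subseteq> \<Delta> \<Longrightarrow> \<Delta> = \<Gamma>"
    using maximal_partial_hom[OF assms(2)] by blast
  have "x \<in> {x. \<exists>a. (x, a) \<in> \<Gamma>} \<and> (THE a. (x, a) \<in> \<Gamma>) = a" if "(x, a) \<in> \<Gamma>0" for x a
    using that \<Gamma>(1) \<Gamma>_unique[OF assms(1) \<Gamma>(2,3), of x] by blast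
  then show ?thesis
    using that place_maximal[OF assms(1) \<Gamma>(2,3)] by blast
qed

section \<open>Places with prescribed values\<close>

text \<open>Splitting off linear factors of \<open>p\<close> one by one. Hence every element of
  \<open>K\<close> outside \<open>range \<iota>\<close> is transcendental over
  \<open>k\<close>.\<close>

lemma root_in_range:
  fixes \<iota> :: "'k::alg_closed_field \<Rightarrow> 'K::field"
  assumes "unital_hom \<iota>" "p \<noteq> 0" "poly (map_poly \<iota> p) z = 0"
  shows "z \<in> range \<iota>"
  using assms(2,3)
proof (induction "degree p" arbitrary: p rule: less_induct)
  case less
  interpret \<iota>: unital_hom \<iota> by (rule assms(1))
  have inj: "\<iota> c \<noteq> 0" if "c \<noteq> 0" for c
    using \<iota>.hom_mult[of c "inverse c"] that by (auto simp: \<iota>.hom_one)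
  have "degree p \<noteq> 0"
  proof
    assume "degree p = 0"
    then obtain c where "p = [:c:]" using degree_eq_zeroE by blast
    with less.prems show False
      using inj[of c] by (auto simp: map_poly_pCons \<iota>.hom_zero)
  qed
  then obtain y where "poly p y = 0"
    using alg_closed_imp_poly_has_root[of p] by auto
  then obtain q where q: "p = [:- y, 1:] * q"
    by (auto simp: poly_eq_0_iff_dvd)
  have "q \<noteq> 0" using less.prems q by auto
  have "(\<iota> (- y) + z) * poly (map_poly \<iota> q) z = 0"
    using less.prems(2) unfolding q \<iota>.map_poly_hom_mult
    by (simp add: map_poly_pCons \<iota>.hom_zero \<iota>.hom_one flip: distrib_right)
  then consider "\<iota> (- y) + z = 0" | "poly (map_poly \<iota> q) z = 0"
    using mult_eq_0_iff by blast
  then show ?case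
  proof cases
    case 1
    then have "z = \<iota> y"
      using \<iota>.hom_add[of "- y" y] by (metis \<iota>.hom_zero add_left_cancel add.left_inverse)
    then show ?thesis by auto
  next
    case 2
    have "degree p = Suc (degree q)"
      unfolding q using \<open>q \<noteq> 0\<close> by (subst degree_mult_eq) auto
    with less.hyps[of q] \<open>q \<noteq> 0\<close> 2 show ?thesis by simp
  qed
qed

text \<open>Since \<open>z\<close> is transcendental, \<open>p(z) \<mapsto> p(0)\<close> is well
  defined on \<open>k[z]\<close>, and it extends to a place.\<close>

lemma place_at_transcendental:
  fixes \<iota> :: "'k::alg_closed_field \<Rightarrow> 'K::field"
  assumes "unital_hom \<iota>" "z \<notin> range \<iota>"
  obtains V g where "place \<iota> V g" "z \<in> V" "g z = 0"
proof -
  interpret \<iota>: unital_hom \<iota> by (rule assms(1))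
  define \<Gamma> where "\<Gamma> = range (\<lambda>p. (poly (map_poly \<iota> p) z, poly p 0))"
  have "partial_hom \<iota> \<Gamma>"
    unfolding partial_hom_def
  proof (intro conjI allI impI)
    fix c show "(\<iota> c, c) \<in> \<Gamma>"
      unfolding \<Gamma>_def by (rule image_eqI[of _ _ "[:c:]"]) (auto simp: map_poly_pCons \<iota>.hom_zero)
  next
    fix a assume "(0, a) \<in> \<Gamma>"
    then obtain p where "poly (map_poly \<iota> p) z = 0" "a = poly p 0"
      by (auto simp: \<Gamma>_def)
    then show "a = 0" using root_in_range[OF assms(1), of p z] assms(2) by (cases "p = 0") auto
  next
    fix x a y b assume "(x, a) \<in> \<Gamma>" "(y, b) \<in> \<Gamma>"
    then obtain p q where "x = poly (map_poly \<iota> p) z" "a = poly p 0"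
        "y = poly (map_poly \<iota> q) z" "b = poly q 0"
      by (auto simp: \<Gamma>_def)
    then show "(x + y, a + b) \<in> \<Gamma>" "(x * y, a * b) \<in> \<Gamma>"
      unfolding \<Gamma>_def by (intro image_eqI[of _ _ "p + q"] image_eqI[of _ _ "p * q"]; simp add: \<iota>.map_poly_hom_add \<iota>.map_poly_hom_mult)+
  qed
  moreover have "(z, 0) \<in> \<Gamma>"
    unfolding \<Gamma>_def by (rule image_eqI[of _ _ "[:0, 1:]"]) (auto simp: map_poly_pCons \<iota>.hom_zero \<iota>.hom_one)
  ultimately show ?thesis
    using place_extending_partial_hom[OF assms(1)] that by metis
qed

text \<open>The assumption is precisely that \<open>z v \<mapsto> c v\<close> is well defined on the
  subring generated by the \<open>z v\<close> over \<open>k\<close>.\<close>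

lemma place_specializing:
  fixes \<iota> :: "'k::alg_closed_field \<Rightarrow> 'K::field" and z :: "'v \<Rightarrow> 'K" and c :: "'v \<Rightarrow> 'k"
  assumes "unital_hom \<iota>" "\<And>P. mpoly_hom \<iota> z P = 0 \<Longrightarrow> mpoly_eval c P = 0"
  obtains V g where "place \<iota> V g" "\<And>v. z v \<in> V \<and> g (z v) = c v"
proof -
  interpret \<iota>: unital_hom \<iota> by (rule assms(1))
  interpret i: unital_hom "\<lambda>x::'k. x" by (rule unital_hom_id)
  define \<Gamma> where "\<Gamma> = range (\<lambda>P. (mpoly_hom \<iota> z P, mpoly_eval c P))"
  have \<Gamma>I: "(mpoly_hom \<iota> z P, mpoly_eval c P) \<in> \<Gamma>" for P
    by (auto simp: \<Gamma>_def)
  have "partial_hom \<iota> \<Gamma>"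
    unfolding partial_hom_def
  proof (intro conjI allI impI)
    fix a show "(\<iota> a, a) \<in> \<Gamma>"
      using \<Gamma>I[of "mpoly_const a"] by (simp add: mpoly_eval_eq_hom i.mpoly_hom_const \<iota>.mpoly_hom_const)
  next
    fix a assume "(0, a) \<in> \<Gamma>"
    then show "a = 0" using assms(2) by (auto simp: \<Gamma>_def)
  next
    fix x a y b assume "(x, a) \<in> \<Gamma>" "(y, b) \<in> \<Gamma>"
    then obtain P Q where "x = mpoly_hom \<iota> z P" "a = mpoly_eval c P"
        "y = mpoly_hom \<iota> z Q" "b = mpoly_eval c Q"
      by (auto simp: \<Gamma>_def)
    then show "(x + y, a + b) \<in> \<Gamma>" "(x * y, a * b) \<in> \<Gamma>"
      using \<Gamma>I[of "P + Q"] \<Gamma>I[of "P * Q"]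
      by (auto simp: mpoly_eval_eq_hom i.mpoly_hom_add i.mpoly_hom_mult \<iota>.mpoly_hom_add \<iota>.mpoly_hom_mult)
  qed
  moreover have "(z v, c v) \<in> \<Gamma>" for v
    using \<Gamma>I[of "mpoly_var v"] by (simp add: mpoly_eval_eq_hom i.mpoly_hom_var \<iota>.mpoly_hom_var)
  ultimately show ?thesis
    using place_extending_partial_hom[OF assms(1)] that by metis
qed


subsection \<open>Common zeros of forms\<close>

lemma dvd_diff_mult:
  fixes a :: "'a::comm_ring_1"
  assumes "a dvd x - y" "a dvd u - v"
  shows "a dvd x * u - y * v"
proof -
  have "x * u - y * v = (x - y) * u + y * (u - v)" by (simp add: algebra_simps)
  then show ?thesis using assms by simp
qed

lemma dvd_diff_mpoly_hom:
  fixes a :: "'a::comm_ring_1"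
  assumes "\<And>i. a dvd x i - y i"
  shows "a dvd mpoly_hom h x F - mpoly_hom h y F"
proof -
  have power: "a dvd x i ^ n - y i ^ n" for i n
    by (induction n) (auto intro: dvd_diff_mult assms)
  have "a dvd (\<Prod>i\<in>A. x i ^ e i) - (\<Prod>i\<in>A. y i ^ e i)" for A e
    by (induction A rule: infinite_finite_induct) (auto intro: dvd_diff_mult power)
  then have "a dvd monom_val x m - monom_val y m" for m
    by (simp add: monom_val_def)
  then have "a dvd (\<Sum>m\<in>Poly_Mapping.keys F. h (Poly_Mapping.lookup F m) * (monom_val x m - monom_val y m))"
    by (intro dvd_sum dvd_mult)
  then show ?thesis
    by (simp add: mpoly_hom_def algebra_simps sum_subtractf)
qed

lemma fps_X_power_dvd_iff:
  fixes f :: "'a::comm_ring_1 fps"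
  shows "fps_X ^ s dvd f \<longleftrightarrow> (\<forall>r<s. fps_nth f r = 0)"
proof
  assume "\<forall>r<s. fps_nth f r = 0"
  then have "f = fps_X ^ s * fps_shift s f"
    by (intro fps_ext) (auto simp: fps_X_power_mult_nth)
  then show "fps_X ^ s dvd f" by (rule dvdI)
qed (auto simp: dvd_def fps_X_power_mult_nth)

text \<open>Banach's iteration for the adic metric of power series: each application of
  \<open>T\<close> gains one order of agreement, starting from 0.\<close>

lemma fps_contraction_fixed_point:
  fixes T :: "('i \<Rightarrow> 'a::comm_ring_1 fps) \<Rightarrow> 'i \<Rightarrow> 'a fps"
  assumes contr: "\<And>x y s i. (\<And>i. fps_X ^ s dvd x i - y i) \<Longrightarrow> fps_X ^ Suc s dvd T x i - T y i"
  obtains x where "T x = x"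
proof
  define z where "z s = (T ^^ s) (\<lambda>_. 0)" for s
  have z_Suc: "z (Suc s) = T (z s)" for s
    by (simp add: z_def)
  have step: "fps_X ^ s dvd z (Suc s) i - z s i" for s i
    by (induction s arbitrary: i) (auto simp: z_Suc intro: contr simp del: power_Suc)
  have far: "fps_X ^ s dvd z (s + k) i - z s i" for s k i
  proof (induction k)
    case (Suc k)
    have "fps_X ^ s dvd z (Suc (s + k)) i - z (s + k) i"
      using step[of "s + k" i] by (rule dvd_trans[rotated]) (simp add: le_imp_power_dvd)
    from dvd_add[OF this Suc] show ?case by simp
  qed simp
  \<comment> \<open>The coefficient of order \<open>s\<close> is final from the iterate
    \<open>Suc s\<close> on, which is determined modulo \<open>fps_X ^ Suc s\<close>.\<close>
  define x where "x i = Abs_fps (\<lambda>s. fps_nth (z (Suc s) i) s)" for i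
  have x: "fps_X ^ s dvd x i - z s i" for s i
    unfolding fps_X_power_dvd_iff
  proof (intro allI impI)
    fix r assume "r < s"
    with far[of "Suc r" "s - Suc r" i] show "fps_nth (x i - z s i) r = 0"
      by (auto simp: fps_X_power_dvd_iff x_def simp del: power_Suc)
  qed
  show "T x = x"
  proof (rule ext, rule fps_ext)
    fix i r
    have "fps_X ^ Suc r dvd T x i - T (z r) i"
      by (rule contr) (rule x)
    from dvd_diff[OF this x[of "Suc r" i, unfolded z_Suc]]
    have "fps_X ^ Suc r dvd T x i - x i" by simp
    then show "fps_nth (T x i) r = fps_nth (x i) r"
      by (auto simp: fps_X_power_dvd_iff simp del: power_Suc)
  qed
qed

lemma mpoly_hom_homogeneous:
  assumes "F \<in> forms e"
  shows "mpoly_hom h (\<lambda>i. c * x i) F = c ^ e * mpoly_hom h x F"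
proof -
  have "monom_val (\<lambda>i. c * x i) m = c ^ e * monom_val x m" if "m \<in> Poly_Mapping.keys F" for m
    using that assms by (auto simp: monom_val_UNIV power_mult_distrib prod.distrib forms_def simp flip: power_sum)
  then show ?thesis
    by (simp add: mpoly_hom_def sum_distrib_left algebra_simps)
qed

lemma unital_hom_fls_const: "unital_hom (fls_const :: 'a::comm_semiring_1 \<Rightarrow> 'a fls)"
  by unfold_locales (auto simp: fls_plus_const fls_const_mult_const)

lemma unital_hom_fps_to_fls: "unital_hom (fps_to_fls :: 'a::comm_semiring_1 fps \<Rightarrow> 'a fls)"
  by unfold_locales (auto simp: fls_times_fps_to_fls)

text \<open>The system \<open>x\<^sub>\<sigma>\<^sub>j / \<epsilon> + f\<^sub>j(x) = 0\<close>, \<open>x\<^sub>i\<^sub>0 = 1\<close>, is solved over \<open>k((\<epsilon>))\<close> by a fixed point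
  iteration, and the solution is specialized at a place with \<open>1 / \<epsilon> \<mapsto> 0\<close>.\<close>

theorem forms_common_zero:
  fixes f :: "'j \<Rightarrow> ('n::finite, 'k::alg_closed_field) mpoly"
  assumes J: "finite J" "card J < card I" and e: "e > 0" and f: "\<And>j. j \<in> J \<Longrightarrow> f j \<in> forms e"
  obtains x where "\<exists>i. x i \<noteq> 0" "\<And>i. i \<notin> I \<Longrightarrow> x i = 0" "\<And>j. j \<in> J \<Longrightarrow> mpoly_eval x (f j) = 0"
proof -
  have "I \<noteq> {}" using J by auto
  then obtain i0 where i0: "i0 \<in> I" by blast
  have "card J \<le> card (I - {i0})" using J i0 by simp
  then obtain \<sigma> where \<sigma>: "\<sigma> ` J \<subseteq> I - {i0}" "inj_on \<sigma> J"
    using card_le_inj[OF J(1), of "I - {i0}"] by auto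
  \<comment> \<open>With \<open>t = 1 / \<epsilon>\<close>, the form \<open>f j\<close> is deformed
    to \<open>f j + t * x (\<sigma> j) * x i0 ^ (e - 1)\<close>. At \<open>t = \<infinity>\<close>
    the deformed system has the evident zero \<open>x i0 = 1\<close>, all other coordinates 0. The
    fixed point of \<open>T\<close> continues this zero to a neighbourhood of
    \<open>t = \<infinity>\<close>; properness of projective space then carries it to
    \<open>t = 0\<close>.\<close>
  define T :: "('n \<Rightarrow> 'k fps) \<Rightarrow> 'n \<Rightarrow> 'k fps" where
    "T x i = (if i = i0 then 1 else if i \<in> \<sigma> ` J
       then - (fps_X * mpoly_hom fps_const x (f (the_inv_into J \<sigma> i))) else 0)" for x i
  have "fps_X ^ Suc s dvd T x i - T y i" if "\<And>i. fps_X ^ s dvd x i - y i" for x y s i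
  proof -
    have "fps_X ^ s dvd mpoly_hom fps_const y F - mpoly_hom fps_const x F" for F
      by (rule dvd_diff_mpoly_hom) (metis that dvd_minus_iff minus_diff_eq)
    then show ?thesis
      by (auto simp: T_def simp flip: right_diff_distrib intro!: mult_dvd_mono)
  qed
  then obtain x where x: "T x = x"
    by (rule fps_contraction_fixed_point[of T])
  interpret c: unital_hom "fps_to_fls :: 'k fps \<Rightarrow> 'k fls"
    by (rule unital_hom_fps_to_fls)
  define X where "X i = fps_to_fls (x i)" for i
  have X_i0: "X i0 = 1"
    using fun_cong[OF x, of i0] by (simp add: X_def T_def)
  have X_out: "X i = 0" if "i \<notin> I" for i
  proof -
    have "i \<noteq> i0" "i \<notin> \<sigma> ` J" using that i0 \<sigma>(1) by auto
    then show ?thesis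
      using fun_cong[OF x, of i] by (simp add: X_def T_def)
  qed
  have X_eq: "fls_X_inv * X (\<sigma> j) = - mpoly_hom fls_const X (f j)" if "j \<in> J" for j
  proof -
    have "\<sigma> j \<noteq> i0" "\<sigma> j \<in> \<sigma> ` J" using \<sigma>(1) that by auto
    then have "x (\<sigma> j) = - (fps_X * mpoly_hom fps_const x (f j))"
      using fun_cong[OF x, of "\<sigma> j"] that \<sigma>(2) by (simp add: T_def the_inv_into_f_f)
    then have "X (\<sigma> j) = - (fls_X * mpoly_hom fls_const X (f j))"
      by (simp add: X_def[abs_def] c.hom_mpoly_hom c.hom_mult)
    then show ?thesis
      by (simp add: mult.assoc[symmetric] fls_X_inv_times_conv_shift)
  qed
  have "(fls_X_inv :: 'k fls) \<notin> range fls_const"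
  proof
    assume "(fls_X_inv :: 'k fls) \<in> range fls_const"
    then obtain c :: 'k where "fls_X_inv = fls_const c" by auto
    then have "fls_nth fls_X_inv (-1) = fls_nth (fls_const c) (-1)" by simp
    then show False by simp
  qed
  then obtain V g where "place fls_const V g" and z: "(fls_X_inv :: 'k fls) \<in> V" "g fls_X_inv = 0"
    by (rule place_at_transcendental[OF unital_hom_fls_const])
  then interpret place fls_const V g by simp
  \<comment> \<open>Homogeneous coordinates are divided by one of least valuation: all become
    integral, and one of them becomes 1, so their residues do not all vanish.\<close>
  obtain i1 where i1: "\<And>i. vle (X i1) (X i)"
    using ex_vle_least[of UNIV X] by auto
  then have nz: "X i1 \<noteq> 0"
    using X_i0 by (metis mult_zero_right vle_def zero_neq_one)
  define y where "y i = inverse (X i1) * X i" for i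
  have y: "y i \<in> V" for i
    using i1[of i] nz by (simp add: vle_divide y_def field_simps)
  have "mpoly_eval (\<lambda>i. g (y i)) (f j) = 0" if "j \<in> J" for j
  proof -
    obtain e' where e': "e = Suc e'" using e by (cases e) auto
    have eq: "mpoly_hom fls_const X (f j) = - (fls_X_inv * X (\<sigma> j))"
      using X_eq[OF that] by simp
    have "mpoly_hom fls_const y (f j) = inverse (X i1) ^ e * mpoly_hom fls_const X (f j)"
      unfolding y_def by (rule mpoly_hom_homogeneous[OF f[OF that]])
    \<comment> \<open>Since \<open>X i0 = 1\<close>, the coordinate \<open>y i0\<close> is the
      scaling factor itself. Thus the perturbation is \<open>1 / \<epsilon>\<close> times an
      integral element and has residue 0.\<close>
    also have "\<dots> = - (fls_X_inv * (y (\<sigma> j) * y i0 ^ e'))"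
      unfolding eq by (simp add: y_def X_i0 e' algebra_simps)
    finally have "g (mpoly_hom fls_const y (f j)) = 0"
      using y z by (simp add: g_uminus V_mult V_power g_mult)
    then show ?thesis
      by (simp add: g_mpoly_hom y)
  qed
  moreover have "g (y i1) \<noteq> 0"
    using nz by (simp add: y_def g_1)
  moreover have "g (y i) = 0" if "i \<notin> I" for i
    using that by (simp add: y_def X_out g_0)
  ultimately show ?thesis
    using that[of "\<lambda>i. g (y i)"] by blast
qed


subsection \<open>Diagonalization over a valuation ring\<close>

context place
begin

definition V_invertible :: "'K ^ 'n ^ 'n \<Rightarrow> bool" where
  "V_invertible P \<longleftrightarrow> (\<forall>i j. P $ i $ j \<in> V) \<and>
     (\<exists>P'. (\<forall>i j. P' $ i $ j \<in> V) \<and> P ** P' = mat 1 \<and> P' ** P = mat 1)"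

lemma V_matrix_mult:
  "(\<And>i j. A $ i $ j \<in> V) \<Longrightarrow> (\<And>i j. B $ i $ j \<in> V) \<Longrightarrow> (A ** B) $ i $ j \<in> V"
  by (auto simp: matrix_matrix_mult_def intro!: V_sum V_mult)

lemma V_invertible_mult:
  assumes "V_invertible P" "V_invertible Q"
  shows "V_invertible (P ** Q)"
proof -
  obtain P' Q' where
    P': "\<And>i j. P' $ i $ j \<in> V" "P ** P' = mat 1" "P' ** P = mat 1" and
    Q': "\<And>i j. Q' $ i $ j \<in> V" "Q ** Q' = mat 1" "Q' ** Q = mat 1"
    using assms unfolding V_invertible_def by blast
  have "(P ** Q) ** (Q' ** P') = P ** (Q ** Q') ** P'" "(Q' ** P') ** (P ** Q) = Q' ** (P' ** P) ** Q"
    by (simp_all only: matrix_mul_assoc)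
  then show ?thesis
    using assms P' Q' unfolding V_invertible_def
    by (auto simp: V_matrix_mult intro!: exI[of _ "Q' ** P'"])
qed

lemma V_invertible_inverse:
  assumes "V_invertible P"
  obtains P' where "V_invertible P'" "P ** P' = mat 1" "P' ** P = mat 1"
  using assms unfolding V_invertible_def by blast

lemma V_invertible_transpose:
  assumes "V_invertible P"
  shows "V_invertible (transpose P)"
proof -
  obtain P' where P': "\<And>i j. P' $ i $ j \<in> V" "P ** P' = mat 1" "P' ** P = mat 1"
    using assms unfolding V_invertible_def by blast
  then have "transpose P ** transpose P' = mat 1" "transpose P' ** transpose P = mat 1"
    by (simp_all flip: matrix_transpose_mul add: transpose_mat)
  then show ?thesis
    using assms P'(1) unfolding V_invertible_def
    by (auto simp: transpose_def intro!: exI[of _ "transpose P'"])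
qed

lemma V_invertible_mat_1: "V_invertible (mat 1)"
  unfolding V_invertible_def
  by (intro conjI exI[of _ "mat 1"] matrix_mul_lid) (auto simp: mat_def V_0 V_1)

text \<open>Multiplication from the left adds \<open>c i\<close> times row \<open>i0\<close> to row
  \<open>i\<close> for all \<open>i\<close> at once, so a single shear clears a whole column; its
  transpose on the right clears a row.\<close>

definition shear :: "('n \<Rightarrow> 'K) \<Rightarrow> 'n \<Rightarrow> 'K ^ 'n ^ 'n" where
  "shear c i0 = (\<chi> i j. (if i = j then 1 else 0) + (if j = i0 then c i else 0))"

lemma shear_mult: "(shear c i0 ** B) $ i $ j = B $ i $ j + c i * B $ i0 $ j"
proof -
  have "(shear c i0 ** B) $ i $ j =
      (\<Sum>k\<in>UNIV. (if i = k then B $ k $ j else 0) + (if k = i0 then c i * B $ k $ j else 0))"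
    unfolding shear_def matrix_matrix_mult_def by (auto intro!: sum.cong simp: distrib_right)
  then show ?thesis by (simp add: sum.distrib)
qed

lemma mult_shear: "(B ** transpose (shear c j0)) $ i $ j = B $ i $ j + B $ i $ j0 * c j"
proof -
  have "(B ** transpose (shear c j0)) $ i $ j = (shear c j0 ** transpose B) $ j $ i"
    by (simp add: matrix_matrix_mult_def transpose_def mult.commute)
  then show ?thesis by (simp add: shear_mult transpose_def mult.commute)
qed

lemma V_invertible_shear:
  fixes c :: "'n::finite \<Rightarrow> 'K"
  assumes "c i0 = 0" "\<And>i. c i \<in> V"
  shows "V_invertible (shear c i0)"
proof -
  have "shear c i0 ** shear b i0 = mat 1" if "b i0 = 0" "\<And>i. b i = - c i" for c b :: "'n \<Rightarrow> 'K"
    by (simp add: vec_eq_iff shear_mult) (use that in \<open>auto simp: shear_def mat_def\<close>)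
  from this[of "\<lambda>i. - c i" c] this[of c "\<lambda>i. - c i"] show ?thesis
    unfolding V_invertible_def using assms
    by (auto simp: shear_def V_0 V_1 V_add V_uminus intro!: exI[of _ "shear (\<lambda>i. - c i) i0"])
qed

text \<open>Gaussian elimination inside \<open>V\<close>: among the untreated rows and columns the
  pivot is an entry of least valuation, so the other entries of its row and column are multiples of
  it by elements of \<open>V\<close>. The map \<open>\<pi>\<close> records the pivot columns in
  place of row and column exchanges.\<close>

lemma pivoting:
  fixes A :: "'K ^ 'n ^ 'n"
  assumes "s \<le> CARD('n)"
  shows "\<exists>P Q I \<pi>. V_invertible P \<and> V_invertible Q \<and> card I = s \<and> inj_on \<pi> I \<and>
    (\<forall>i\<in>I. \<forall>j. j \<noteq> \<pi> i \<longrightarrow> (P ** A ** Q) $ i $ j = 0) \<and>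
    (\<forall>i\<in>I. \<forall>i'. i' \<noteq> i \<longrightarrow> (P ** A ** Q) $ i' $ \<pi> i = 0)"
  using assms
proof (induction s)
  case 0
  then show ?case
    by (intro exI[of _ "mat 1"] exI[of _ "{}"]) (auto simp: V_invertible_mat_1)
next
  case (Suc s)
  then obtain P Q I \<pi> where PQ: "V_invertible P" "V_invertible Q" and I: "card I = s" "inj_on \<pi> I"
    and row: "\<And>i j. i \<in> I \<Longrightarrow> j \<noteq> \<pi> i \<Longrightarrow> (P ** A ** Q) $ i $ j = 0"
    and col: "\<And>i i'. i \<in> I \<Longrightarrow> i' \<noteq> i \<Longrightarrow> (P ** A ** Q) $ i' $ \<pi> i = 0"
    by (auto dest: Suc_leD)
  define B where "B = P ** A ** Q"
  have "card (\<pi> ` I) = s" using I by (simp add: card_image)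
  then have "I \<noteq> UNIV" "\<pi> ` I \<noteq> UNIV"
    using I Suc.prems by auto
  then have "(- I) \<times> (- (\<pi> ` I)) \<noteq> {}" by auto
  from ex_vle_least[OF _ this, of "\<lambda>(i, j). B $ i $ j"] obtain i0 j0 where
    i0: "i0 \<notin> I" and j0: "j0 \<notin> \<pi> ` I" and
    least: "\<And>i j. i \<notin> I \<Longrightarrow> j \<notin> \<pi> ` I \<Longrightarrow> vle (B $ i0 $ j0) (B $ i $ j)"
    by auto
  have row: "B $ i $ j = 0" if "i \<in> I" "j \<noteq> \<pi> i" for i j
    using row[OF that] by (simp add: B_def)
  have col: "B $ i' $ \<pi> i = 0" if "i \<in> I" "i' \<noteq> i" for i i'
    using col[OF that] by (simp add: B_def)
  \<comment> \<open>Multipliers vanish on treated rows, where column \<open>j0\<close> is already 0;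
    the zero pattern obtained so far therefore survives.\<close>
  have "\<exists>c\<in>V. (i \<in> I \<longrightarrow> c = 0) \<and> (if i = i0 then c = 0 else B $ i $ j0 = c * B $ i0 $ j0)" for i
  proof (cases "i \<in> I \<or> i = i0")
    case True
    then show ?thesis using V_0 row[of i j0] j0 i0 by (intro bexI[of _ 0]) auto
  next
    case False
    then show ?thesis using least[of i j0] j0 by (auto simp: vle_def)
  qed
  then obtain c where c: "\<And>i. c i \<in> V" "\<And>i. i \<in> I \<Longrightarrow> c i = 0" "c i0 = 0"
    "\<And>i. i \<noteq> i0 \<Longrightarrow> B $ i $ j0 = c i * B $ i0 $ j0"
    by metis
  have "\<exists>c\<in>V. (j \<in> \<pi> ` I \<longrightarrow> c = 0) \<and> (if j = j0 then c = 0 else B $ i0 $ j = B $ i0 $ j0 * c)" for j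
  proof (cases "j \<in> \<pi> ` I \<or> j = j0")
    case True
    then show ?thesis using V_0 col[of _ i0] j0 i0 by (intro bexI[of _ 0]) auto
  next
    case False
    then show ?thesis using least[of i0 j] i0 by (auto simp: vle_def mult.commute)
  qed
  then obtain e where e: "\<And>j. e j \<in> V" "\<And>j. j \<in> \<pi> ` I \<Longrightarrow> e j = 0" "e j0 = 0"
    "\<And>j. j \<noteq> j0 \<Longrightarrow> B $ i0 $ j = B $ i0 $ j0 * e j"
    by metis
  define S where "S = shear (\<lambda>i. - c i) i0"
  define T where "T = transpose (shear (\<lambda>j. - e j) j0)"
  have ST: "V_invertible S" "V_invertible T"
    using c e by (auto simp: S_def T_def V_uminus intro!: V_invertible_shear V_invertible_transpose)
  have B': "((S ** P) ** A ** (Q ** T)) $ i $ j =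
      (B $ i $ j - c i * B $ i0 $ j) - (B $ i $ j0 - c i * B $ i0 $ j0) * e j" for i j
  proof -
    have "(S ** P) ** A ** (Q ** T) = S ** B ** T"
      by (simp add: B_def matrix_mul_assoc)
    then show ?thesis
      by (simp add: S_def T_def mult_shear shear_mult)
  qed
  have "card (insert i0 I) = Suc s" using i0 I by simp
  moreover have "inj_on (\<pi>(i0 := j0)) (insert i0 I)"
    using I(2) i0 j0 by (auto simp: inj_on_def)
  moreover have "((S ** P) ** A ** (Q ** T)) $ i $ j = 0"
    if "i \<in> insert i0 I" "j \<noteq> (\<pi>(i0 := j0)) i" for i j
  proof (cases "i = i0")
    case True
    with that(2) have "B $ i0 $ j = B $ i0 $ j0 * e j" by (simp add: e(4))
    with True show ?thesis by (simp add: B' c(3))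
  next
    case False
    with that have "i \<in> I" "j \<noteq> \<pi> i" "j0 \<noteq> \<pi> i" using j0 by auto
    then show ?thesis by (simp add: B' c(2) row)
  qed
  moreover have "((S ** P) ** A ** (Q ** T)) $ i' $ (\<pi>(i0 := j0)) i = 0"
    if "i \<in> insert i0 I" "i' \<noteq> i" for i i'
  proof (cases "i = i0")
    case True
    with that(2) have "B $ i' $ j0 = c i' * B $ i0 $ j0" by (simp add: c(4))
    with True show ?thesis by (simp add: B' e(3))
  next
    case False
    with that have "i \<in> I" "i0 \<noteq> i" "e (\<pi> i) = 0" using i0 e(2) by auto
    with False that(2) show ?thesis by (simp add: B' col)
  qed
  ultimately show ?case
    using V_invertible_mult[OF ST(1) PQ(1)] V_invertible_mult[OF PQ(2) ST(2)] by blast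
qed

text \<open>After all rows are treated, the matrix is diagonal up to the permutation
  \<open>\<pi>\<close>, whose matrix \<open>M\<close> is absorbed into the right factor.\<close>

lemma smith_decomposition:
  fixes A :: "'K ^ 'n ^ 'n"
  obtains P Q D where "V_invertible P" "V_invertible Q" "A = P ** (\<chi> i j. if i = j then D i else 0) ** Q"
proof -
  obtain P Q I \<pi> where PQ: "V_invertible P" "V_invertible Q" and I: "card I = CARD('n)" "inj_on \<pi> I"
    and row: "\<And>i j. i \<in> I \<Longrightarrow> j \<noteq> \<pi> i \<Longrightarrow> (P ** A ** Q) $ i $ j = 0"
    using pivoting[of "CARD('n)" A] by auto
  have "I = UNIV" using I(1) by (simp add: card_eq_UNIV_imp_eq_UNIV)
  with I have "inj \<pi>" by simp
  define D where "D i = (P ** A ** Q) $ i $ \<pi> i" for i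
  define M :: "'K ^ 'n ^ 'n" where "M = (\<chi> i j. if j = \<pi> i then 1 else 0)"
  have PAQ: "P ** A ** Q = (\<chi> i j. if i = j then D i else 0) ** M"
  proof -
    have "((\<chi> i j. if i = j then D i else 0) ** M) $ i $ j =
        (\<Sum>k\<in>UNIV. if i = k then (if j = \<pi> k then D k else 0) else 0)" for i j
      by (simp only: matrix_matrix_mult_def M_def vec_lambda_beta, intro sum.cong refl, simp)
    then show ?thesis
      using row \<open>I = UNIV\<close> by (simp add: vec_eq_iff D_def)
  qed
  have "M ** transpose M = mat 1"
  proof -
    have "(M ** transpose M) $ i $ j = (\<Sum>k\<in>UNIV. if k = \<pi> i then (if k = \<pi> j then 1 else 0) else 0)" for i j
      by (simp only: matrix_matrix_mult_def M_def transpose_def vec_lambda_beta, intro sum.cong refl, simp)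
    then show ?thesis
      using \<open>inj \<pi>\<close> by (simp add: vec_eq_iff mat_def inj_eq)
  qed
  moreover from this have "transpose M ** M = mat 1"
    by (simp add: matrix_left_right_inverse)
  ultimately have M: "V_invertible M"
    unfolding V_invertible_def by (intro conjI exI[of _ "transpose M"]) (auto simp: M_def transpose_def V_0 V_1)
  obtain P' where P': "V_invertible P'" "P' ** P = mat 1"
    using V_invertible_inverse[OF PQ(1)] by metis
  obtain Q' where Q': "V_invertible Q'" "Q ** Q' = mat 1"
    using V_invertible_inverse[OF PQ(2)] by metis
  have "A = (P' ** P) ** A ** (Q ** Q')"
    by (simp add: P' Q')
  also have "\<dots> = P' ** (P ** A ** Q) ** Q'"
    by (simp only: matrix_mul_assoc)
  also have "\<dots> = P' ** (\<chi> i j. if i = j then D i else 0) ** (M ** Q')"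
    by (simp only: PAQ matrix_mul_assoc)
  finally show ?thesis
    using that P'(1) V_invertible_mult[OF M Q'(1)] by blast
qed

subsection \<open>The numerical criterion\<close>

lemma vle_mult: "vle x y \<Longrightarrow> vle x' y' \<Longrightarrow> vle (x * x') (y * y')"
proof -
  assume "vle x y" "vle x' y'"
  then obtain c c' where "c \<in> V" "c' \<in> V" "y = c * x" "y' = c' * x'" by (auto simp: vle_def)
  then show ?thesis unfolding vle_def by (intro bexI[of _ "c * c'"]) (auto simp: V_mult)
qed

lemma vle_power: "vle x y \<Longrightarrow> vle (x ^ n) (y ^ n)"
  by (induction n) (auto simp: vle_refl vle_mult)

lemma vle_prod: "(\<And>i. i \<in> A \<Longrightarrow> vle (f i) (f' i)) \<Longrightarrow> vle (prod f A) (prod f' A)"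
  by (induction A rule: infinite_finite_induct) (auto simp: vle_refl vle_mult)

lemma vle_V: "vle x y \<Longrightarrow> x \<in> V \<Longrightarrow> y \<in> V"
  by (auto simp: vle_def V_mult)

lemma not_V_mult: "x \<notin> V \<Longrightarrow> y \<notin> V \<Longrightarrow> x * y \<notin> V"
proof
  assume *: "x \<notin> V" "y \<notin> V" "x * y \<in> V"
  then have "x * y * (inverse x * inverse y) = 1"
    using V_0 by (auto simp: field_simps)
  then have "g (x * y) * (g (inverse x) * g (inverse y)) = 1"
    using * inverse_V by (metis g_mult V_mult g_1)
  then show False using * inverse_V by simp
qed

lemma not_V_prod:
  assumes "finite A" "A \<noteq> {}" "\<And>i. i \<in> A \<Longrightarrow> f i \<notin> V"
  shows "prod f A \<notin> V"
  using assms by (induction A rule: finite_ne_induct) (auto simp: not_V_mult)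

lemma vle_monom_val:
  fixes m :: "'n::finite \<Rightarrow>\<^sub>0 nat"
  assumes "\<And>i. i \<in> Poly_Mapping.keys m \<Longrightarrow> vle (D i) w"
  shows "vle (monom_val D m) (w ^ (\<Sum>i\<in>UNIV. Poly_Mapping.lookup m i))"
  unfolding monom_val_UNIV power_sum
proof (rule vle_prod)
  fix i
  show "vle (D i ^ Poly_Mapping.lookup m i) (w ^ Poly_Mapping.lookup m i)"
    using assms[of i] by (cases "i \<in> Poly_Mapping.keys m") (auto simp: vle_power in_keys_iff vle_refl)
qed

text \<open>Since \<open>vle\<close> is only a total preorder on values, the number of strictly
  smaller entries serves as a numerical key for sorting.\<close>

lemma ex_vle_enumeration:
  fixes D :: "'n::finite \<Rightarrow> 'K"
  obtains \<sigma> :: "nat \<Rightarrow> 'n" where "bij_betw \<sigma> {..<CARD('n)} UNIV"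
    "\<And>a b. a \<le> b \<Longrightarrow> b < CARD('n) \<Longrightarrow> vle (D (\<sigma> a)) (D (\<sigma> b))"
proof -
  define rank where "rank i = card {j. \<not> vle (D i) (D j)}" for i
  have rank: "vle (D i) (D j)" if "rank i \<le> rank j" for i j
  proof (rule ccontr)
    assume j: "\<not> vle (D i) (D j)"
    then have ji: "vle (D j) (D i)" using vle_total by blast
    have "{l. \<not> vle (D j) (D l)} \<subseteq> {l. \<not> vle (D i) (D l)}"
      using vle_trans[OF ji] by auto
    moreover have "j \<in> {l. \<not> vle (D i) (D l)} - {l. \<not> vle (D j) (D l)}"
      using j vle_refl by auto
    ultimately have "rank j < rank i"
      unfolding rank_def by (intro psubset_card_mono) auto
    with that show False by simp
  qed
  obtain xs0 :: "'n list" where xs0: "set xs0 = UNIV" "distinct xs0"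
    using finite_distinct_list[of "UNIV :: 'n set"] by auto
  define xs where "xs = sort_key rank xs0"
  have xs: "set xs = UNIV" "distinct xs" "sorted (map rank xs)"
    using xs0 by (auto simp: xs_def)
  then have len: "length xs = CARD('n)"
    by (metis distinct_card)
  show ?thesis
  proof (rule that[of "(!) xs"])
    show "bij_betw ((!) xs) {..<CARD('n)} UNIV"
      using bij_betw_nth[OF xs(2), of "{..<CARD('n)}" UNIV] len xs(1) by simp
    show "vle (D (xs ! a)) (D (xs ! b))" if "a \<le> b" "b < CARD('n)" for a b
      using sorted_nth_mono[OF xs(3) that(1)] that len by (intro rank) auto
  qed
qed

text \<open>Let \<open>w\<^sub>0 \<le> \<dots> \<le> w\<^sub>n\<close> be the valuations of the \<open>D i\<close>, with sum \<open>0\<close>. The last hypothesis, for \<open>I\<close> the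
  first \<open>k + 1\<close> indices, gives \<open>w\<^sub>n\<^sub>-\<^sub>k + (d - 1) w\<^sub>k \<ge> 0\<close> whenever \<open>2 k \<le> n\<close>; summing over the lower half
  shows that the lower half of the weights has sum \<open>\<ge> 0\<close>, so all of them vanish.\<close>

lemma weights_trivial:
  fixes D :: "'n::finite \<Rightarrow> 'K" and S :: "('n \<Rightarrow>\<^sub>0 nat) set"
  assumes nz: "\<And>i. D i \<noteq> 0" and d: "d \<ge> 3"
    and deg: "\<And>m. m \<in> S \<Longrightarrow> (\<Sum>i\<in>UNIV. Poly_Mapping.lookup m i) = d"
    and weight: "\<And>m. m \<in> S \<Longrightarrow> monom_val D m \<in> V"
    and unit: "(\<Prod>i\<in>UNIV. D i) \<in> V" "inverse (\<Prod>i\<in>UNIV. D i) \<in> V"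
    and S: "\<And>I. I \<noteq> {} \<Longrightarrow> (\<exists>m\<in>S. Poly_Mapping.keys m \<subseteq> I) \<or>
      card I \<le> card {j. j \<notin> I \<and> (\<exists>m\<in>S. Poly_Mapping.lookup m j > 0 \<and>
        Poly_Mapping.keys (m - Poly_Mapping.single j 1) \<subseteq> I)}"
  shows "D i \<in> V"
proof -
  define N where "N = CARD('n)"
  have "N > 0" by (simp add: N_def)
  obtain \<sigma> where \<sigma>: "bij_betw \<sigma> {..<N} UNIV"
    and sorted: "\<And>a b. a \<le> b \<Longrightarrow> b < N \<Longrightarrow> vle (D (\<sigma> a)) (D (\<sigma> b))"
    using ex_vle_enumeration[of D] unfolding N_def by metis
  define w where "w a = D (\<sigma> a)" for a
  define u where "u = (\<Prod>i\<in>UNIV. D i)"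
  have u: "u = (\<Prod>a<N. w a)"
    unfolding u_def w_def by (rule prod.reindex_bij_betw[OF \<sigma>, symmetric])
  have wnz: "w a \<noteq> 0" for a using nz by (simp add: w_def)
  have E: "w (N - 1 - k) * w k ^ (d - 1) \<in> V" if "2 * k < N" for k
  proof -
    define I where "I = \<sigma> ` {..k}"
    have inj: "inj_on \<sigma> {..<N}" using \<sigma> by (simp add: bij_betw_def)
    have cardI: "card I = Suc k"
      unfolding I_def using that by (subst card_image) (auto intro: inj_on_subset[OF inj])
    have I: "vle (D i) (w k)" if "i \<in> I" for i
      using that sorted[of _ k] \<open>2 * k < N\<close> by (auto simp: I_def w_def)
    have "I \<noteq> {}" by (auto simp: I_def)
    from S[OF this] show ?thesis
    proof
      assume "\<exists>m\<in>S. Poly_Mapping.keys m \<subseteq> I"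
      then obtain m where m: "m \<in> S" "Poly_Mapping.keys m \<subseteq> I" by blast
      have "vle (monom_val D m) (w k ^ d)"
        using vle_monom_val[of m D "w k"] m I deg[OF m(1)] by auto
      moreover have "vle (w k * w k ^ (d - 1)) (w (N - 1 - k) * w k ^ (d - 1))"
        using that by (intro vle_mult vle_refl) (auto simp: w_def intro!: sorted)
      moreover have "w k * w k ^ (d - 1) = w k ^ d"
        using d by (metis power_eq_if not_numeral_le_zero)
      ultimately show ?thesis
        using vle_V weight[OF m(1)] by metis
    next
      let ?J = "{j. j \<notin> I \<and> (\<exists>m\<in>S. Poly_Mapping.lookup m j > 0 \<and>
        Poly_Mapping.keys (m - Poly_Mapping.single j 1) \<subseteq> I)}"
      assume J: "card I \<le> card ?J"
      \<comment> \<open>Pigeonhole: only \<open>k\<close> positions lie above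
        \<open>N - 1 - k\<close>, while \<open>?J\<close> has at least \<open>k + 1\<close>
        elements.\<close>
      have "\<exists>b\<le>N - 1 - k. \<sigma> b \<in> ?J"
      proof (rule ccontr)
        assume *: "\<not> ?thesis"
        have "?J \<subseteq> \<sigma> ` {N - k..<N}"
        proof
          fix j assume j: "j \<in> ?J"
          obtain b where b: "b < N" "j = \<sigma> b"
            using \<sigma> by (metis UNIV_I bij_betw_def imageE lessThan_iff)
          with * j have "\<not> b \<le> N - 1 - k" by blast
          with b show "j \<in> \<sigma> ` {N - k..<N}" by auto
        qed
        then have "card ?J \<le> card {N - k..<N}"
          by (meson card_image_le card_mono finite_atLeastLessThan finite_imageI le_trans)
        with J cardI that show False by simp
      qed
      then obtain b m where b: "b \<le> N - 1 - k" and m: "m \<in> S" "Poly_Mapping.lookup m (\<sigma> b) > 0"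
        "Poly_Mapping.keys (m - Poly_Mapping.single (\<sigma> b) 1) \<subseteq> I"
        by blast
      define m' where "m' = m - Poly_Mapping.single (\<sigma> b) 1"
      have mm': "m = Poly_Mapping.single (\<sigma> b) 1 + m'"
        using m(2) by (intro poly_mapping_eqI) (auto simp: m'_def lookup_add lookup_minus lookup_single when_def)
      have "(\<Sum>i\<in>UNIV. Poly_Mapping.lookup m i) = 1 + (\<Sum>i\<in>UNIV. Poly_Mapping.lookup m' i)"
        unfolding mm' lookup_add sum.distrib by (simp add: lookup_single when_def)
      then have "(\<Sum>i\<in>UNIV. Poly_Mapping.lookup m' i) = d - 1"
        using deg[OF m(1)] by simp
      then have "vle (monom_val D m') (w k ^ (d - 1))"
        using vle_monom_val[of m' D "w k"] m(3) I by (auto simp: m'_def)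
      moreover have "vle (w b) (w (N - 1 - k))"
        unfolding w_def using b \<open>N > 0\<close> by (intro sorted) auto
      ultimately have "vle (w b * monom_val D m') (w (N - 1 - k) * w k ^ (d - 1))"
        by (intro vle_mult)
      moreover have "monom_val D m = w b * monom_val D m'"
        unfolding mm' monom_val_add by (simp add: w_def)
      ultimately show ?thesis
        using vle_V weight[OF m(1)] by metis
    qed
  qed
  define q where "q = N div 2"
  \<comment> \<open>Lower half, middle and upper half of the weights; the middle factor
    \<open>M\<close> is a single weight for odd \<open>N\<close> and empty otherwise.\<close>
  define W where "W = (\<Prod>a<q. w a)"
  define M where "M = (\<Prod>a\<in>{q..<N - q}. w a)"
  define Z where "Z = (\<Prod>a\<in>{N - q..<N}. w a)"
  have "M \<in> V"
    unfolding M_def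
  proof (rule V_prod)
    fix a assume "a \<in> {q..<N - q}"
    then have a: "2 * a < N" "N - 1 - a = a" by (auto simp: q_def)
    from E[OF a(1)] a(2) have "w a ^ Suc (d - 1) \<in> V" by simp
    then show "w a \<in> V" using V_power_D by blast
  qed
  have "Z = (\<Prod>k<q. w (N - 1 - k))"
    unfolding Z_def
    by (rule prod.reindex_bij_witness[of _ "\<lambda>k. N - 1 - k" "\<lambda>a. N - 1 - a"]) (auto simp: q_def)
  then have "Z * W ^ (d - 1) = (\<Prod>k<q. w (N - 1 - k) * w k ^ (d - 1))"
    by (simp add: W_def prod.distrib prod_power_distrib)
  also have "\<dots> \<in> V"
    by (rule V_prod, rule E) (auto simp: q_def)
  finally have ZW: "Z * W ^ (d - 1) \<in> V" .
  have uWMZ: "u = W * M * Z"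
    unfolding u W_def M_def Z_def lessThan_atLeast0
    by (subst prod.atLeastLessThan_concat, simp, simp add: q_def)
      (subst prod.atLeastLessThan_concat; simp)
  \<comment> \<open>Dividing \<open>Z * W ^ (d - 1)\<close> by the unit \<open>u = W * M * Z\<close>
    cancels the upper half. The remaining exponent is positive, so \<open>W\<close> itself is
    integral.\<close>
  have "W ^ (d - 2) = inverse u * (M * (Z * W ^ (d - 1)))"
  proof -
    define e where "e = d - 2"
    have e: "d - 2 = e" "d - 1 = Suc e" using d by (auto simp: e_def)
    have "u \<noteq> 0" using nz by (simp add: u_def)
    then show ?thesis
      unfolding e by (simp add: uWMZ field_simps)
  qed
  moreover have "u \<in> V" and iu: "inverse u \<in> V" using unit by (simp_all add: u_def)
  ultimately have "W ^ (d - 2) \<in> V"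
    using \<open>M \<in> V\<close> ZW by (simp add: V_mult)
  then have WV: "W \<in> V" using V_power_D d by auto
  \<comment> \<open>By the ordering, a negative weight in the upper half would make every weight of
    the lower half negative, contradicting \<open>W \<in> V\<close>.\<close>
  have upper: "w a \<in> V" if "q \<le> a" "a < N" for a
  proof (rule ccontr)
    assume "w a \<notin> V"
    then have nV: "w b \<notin> V" if "b \<le> a" for b
      using sorted[OF that \<open>a < N\<close>] vle_V unfolding w_def by blast
    show False
    proof (cases "q = 0")
      case True
      then have "N = 1" using \<open>N > 0\<close> by (simp add: q_def)
      with that \<open>w a \<notin> V\<close> \<open>u \<in> V\<close> show False by (simp add: u)
    next
      case False
      then have "W \<notin> V"
        unfolding W_def using nV that by (intro not_V_prod) auto
      with WV show False by simp
    qed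
  qed
  \<comment> \<open>All factors of \<open>u\<close> besides the largest weight have an integral
    product, so the largest weight is at most 0. Then all weights are at most 0, and their sum being
    0 makes each of them 0.\<close>
  have last: "inverse (w (N - 1)) \<in> V"
  proof -
    have "{..<N} = insert (N - 1) {..<N - 1}"
      using \<open>N > 0\<close> by auto
    then have "u = w (N - 1) * (\<Prod>a<N - 1. w a)"
      unfolding u by simp
    also have "(\<Prod>a<N - 1. w a) = W * (\<Prod>a\<in>{q..<N - 1}. w a)"
      unfolding W_def lessThan_atLeast0 using \<open>N > 0\<close>
      by (subst prod.atLeastLessThan_concat) (auto simp: q_def)
    finally have "u = w (N - 1) * (W * (\<Prod>a\<in>{q..<N - 1}. w a))" .
    then have "inverse (w (N - 1)) = inverse u * (W * (\<Prod>a\<in>{q..<N - 1}. w a))"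
      using nz wnz by (auto simp: field_simps u_def)
    then show ?thesis
      using iu WV upper by (auto intro!: V_mult V_prod)
  qed
  have inv: "inverse (D j) \<in> V" for j
  proof -
    obtain a where a: "a < N" "j = \<sigma> a"
      using \<sigma> by (metis UNIV_I bij_betw_def imageE lessThan_iff)
    then have "vle (w a) (w (N - 1))"
      unfolding w_def by (intro sorted) auto
    then obtain c where c: "c \<in> V" "w (N - 1) = c * w a" by (auto simp: vle_def)
    then have "inverse (w a) = c * inverse (w (N - 1))"
      using wnz[of "N - 1"] by (auto simp: field_simps)
    then show ?thesis
      using V_mult[OF c(1) last] a(2) by (simp only: w_def)
  qed
  have "u = D i * (\<Prod>j\<in>UNIV - {i}. D j)"
    unfolding u_def by (rule prod.remove) auto
  moreover have "(\<Prod>j\<in>UNIV - {i}. D j) * (\<Prod>j\<in>UNIV - {i}. inverse (D j)) = 1"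
    using nz by (simp flip: prod.distrib)
  ultimately have "D i = u * (\<Prod>j\<in>UNIV - {i}. inverse (D j))"
    by (simp add: mult.assoc)
  then show ?thesis
    using \<open>u \<in> V\<close> inv by (metis V_mult V_prod)
qed

end


subsection \<open>Non-singular forms\<close>

definition singular_at :: "('n \<Rightarrow> 'a::comm_semiring_1) \<Rightarrow> ('n, 'a) mpoly \<Rightarrow> bool" where
  "singular_at x F \<longleftrightarrow> mpoly_eval x F = 0 \<and> (\<forall>i. mpoly_eval x (mpoly_pderiv i F) = 0)"

lemma mpoly_eval_pderiv:
  "mpoly_eval x (mpoly_pderiv i F) = (\<Sum>m\<in>Poly_Mapping.keys F. of_nat (Poly_Mapping.lookup m i) *
     Poly_Mapping.lookup F m * monom_val x (m - Poly_Mapping.single i 1))"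
  unfolding mpoly_eval_eq_hom mpoly_pderiv_def
  by (simp add: unital_hom.mpoly_hom_sum[OF unital_hom_id] unital_hom.mpoly_hom_single[OF unital_hom_id])

lemma forms_pderiv:
  assumes "F \<in> forms d"
  shows "mpoly_pderiv i F \<in> forms (d - 1)"
  unfolding mpoly_pderiv_def
proof (rule forms_sum)
  fix m assume m: "m \<in> Poly_Mapping.keys F"
  show "Poly_Mapping.single (m - Poly_Mapping.single i 1)
      (of_nat (Poly_Mapping.lookup m i) * Poly_Mapping.lookup F m) \<in> forms (d - 1)"
  proof (cases "Poly_Mapping.lookup m i = 0")
    case True
    then show ?thesis by (simp add: forms_0)
  next
    case False
    have "Poly_Mapping.lookup m j = (if j = i then 1 else 0) + Poly_Mapping.lookup (m - Poly_Mapping.single i 1) j" for j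
      using False by (simp add: lookup_minus lookup_single when_def)
    then have "(\<Sum>j\<in>UNIV. Poly_Mapping.lookup m j) =
        (\<Sum>j\<in>UNIV. (if j = i then 1 else 0) + Poly_Mapping.lookup (m - Poly_Mapping.single i 1) j)"
      by simp
    also have "\<dots> = 1 + (\<Sum>j\<in>UNIV. Poly_Mapping.lookup (m - Poly_Mapping.single i 1) j)"
      by (simp add: sum.distrib)
    finally show ?thesis
      using assms m by (auto simp: forms_def)
  qed
qed

lemma unital_hom_const_poly: "unital_hom (\<lambda>c::'a::comm_semiring_1. [:c:])"
  by unfold_locales (auto simp: one_pCons mult.commute)

text \<open>\<open>F\<close> is restricted to the line \<open>x + t v\<close>; its value and its
  formal derivative at \<open>t = 0\<close> encode the value of \<open>F\<close> and the derivative
  in direction \<open>v\<close>, in any characteristic.\<close>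

lemma poly_taylor_0:
  fixes x v :: "'n \<Rightarrow> 'a::comm_semiring_1"
  shows "poly (mpoly_hom (\<lambda>c. [:c:]) (\<lambda>i. [:x i, v i:]) F) 0 = mpoly_eval x F"
proof -
  interpret p: unital_hom "\<lambda>p. poly p (0::'a)"
    by unfold_locales auto
  show ?thesis
    by (simp add: p.hom_mpoly_hom mpoly_eval_eq_hom)
qed

lemma poly_taylor_1:
  fixes x v :: "'n::finite \<Rightarrow> 'a::idom"
  shows "poly (pderiv (mpoly_hom (\<lambda>c. [:c:]) (\<lambda>i. [:x i, v i:]) F)) 0 =
    (\<Sum>i\<in>UNIV. v i * mpoly_eval x (mpoly_pderiv i F))"
proof -
  let ?L = "\<lambda>i. [:x i, v i:]"
  have M: "poly (pderiv (monom_val ?L m)) 0 =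
      (\<Sum>i\<in>UNIV. v i * (of_nat (Poly_Mapping.lookup m i) * monom_val x (m - Poly_Mapping.single i 1)))" for m
  proof -
    have "monom_val x (m - Poly_Mapping.single i 1) =
        (\<Prod>j\<in>UNIV - {i}. x j ^ Poly_Mapping.lookup m j) * x i ^ (Poly_Mapping.lookup m i - 1)" for i
    proof -
      have "(\<Prod>j\<in>UNIV - {i}. x j ^ Poly_Mapping.lookup (m - Poly_Mapping.single i 1) j) =
          (\<Prod>j\<in>UNIV - {i}. x j ^ Poly_Mapping.lookup m j)"
        by (rule prod.cong) (auto simp: lookup_minus lookup_single when_def)
      then show ?thesis
        unfolding monom_val_UNIV
        by (subst prod.remove[of _ i]) (auto simp: lookup_minus lookup_single mult.commute)
    qed
    then show ?thesis
      unfolding monom_val_UNIV[of ?L] pderiv_prod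
      by (simp add: poly_sum poly_prod pderiv_power pderiv_pCons mult_ac)
  qed
  have pderiv_sum: "pderiv (\<Sum>m\<in>A. f m) = (\<Sum>m\<in>A. pderiv (f m))" for A and f :: "('n \<Rightarrow>\<^sub>0 nat) \<Rightarrow> 'a poly"
    by (induction A rule: infinite_finite_induct) (simp_all add: pderiv_add)
  have "pderiv (mpoly_hom (\<lambda>c. [:c:]) ?L F) =
      (\<Sum>m\<in>Poly_Mapping.keys F. smult (Poly_Mapping.lookup F m) (pderiv (monom_val ?L m)))"
    by (simp add: mpoly_hom_def pderiv_sum pderiv_smult)
  then have "poly (pderiv (mpoly_hom (\<lambda>c. [:c:]) ?L F)) 0 =
      (\<Sum>m\<in>Poly_Mapping.keys F. \<Sum>i\<in>UNIV. v i * (of_nat (Poly_Mapping.lookup m i) *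
        Poly_Mapping.lookup F m * monom_val x (m - Poly_Mapping.single i 1)))"
    by (simp add: poly_sum M sum_distrib_left mult_ac)
  also have "\<dots> = (\<Sum>i\<in>UNIV. v i * mpoly_eval x (mpoly_pderiv i F))"
    by (subst sum.swap) (simp add: mpoly_eval_pderiv sum_distrib_left)
  finally show ?thesis .
qed

text \<open>The matrix \<open>A\<close> maps the line through \<open>x\<close> with direction
  \<open>v\<close> to the line through \<open>A x\<close> with direction \<open>A v\<close>. Taking
  for \<open>v\<close> the columns of the right inverse \<open>B\<close> reaches every coordinate
  direction.\<close>

lemma singular_at_lin_subst:
  fixes F :: "('n::finite, 'a::idom) mpoly"
  assumes sing: "singular_at x (lin_subst (\<lambda>c. c) A F)" and inv: "A ** B = mat 1"
  shows "singular_at (\<lambda>i. \<Sum>j\<in>UNIV. A $ i $ j * x j) F"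
proof -
  interpret c: unital_hom "\<lambda>c::'a. [:c:]"
    by (rule unital_hom_const_poly)
  let ?y = "\<lambda>i. \<Sum>j\<in>UNIV. A $ i $ j * x j"
  have lin: "(\<Sum>j\<in>UNIV. [:A $ i $ j:] * [:x j, v j:]) = [:?y i, \<Sum>j\<in>UNIV. A $ i $ j * v j:]" for i v
    by (rule poly_eqI) (simp add: coeff_sum coeff_pCons mult.commute split: nat.split)
  have line: "mpoly_hom (\<lambda>c. [:c:]) (\<lambda>i. [:x i, v i:]) (lin_subst (\<lambda>c. c) A F) =
      mpoly_hom (\<lambda>c. [:c:]) (\<lambda>i. [:?y i, \<Sum>j\<in>UNIV. A $ i $ j * v j:]) F" for v
    unfolding c.mpoly_hom_lin_subst lin ..
  have "mpoly_eval ?y F = 0"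
    using sing arg_cong[OF line[of "\<lambda>_. 0"], of "\<lambda>p. poly p 0"]
    unfolding poly_taylor_0 singular_at_def by simp
  moreover have "mpoly_eval ?y (mpoly_pderiv a F) = 0" for a
  proof -
    have "(\<Sum>j\<in>UNIV. A $ i $ j * B $ j $ a) = (if i = a then 1 else 0)" for i
      using arg_cong[OF inv, of "\<lambda>M. M $ i $ a"] by (simp add: matrix_matrix_mult_def mat_def)
    then have "(\<Sum>i\<in>UNIV. (if i = a then 1 else 0) * mpoly_eval ?y (mpoly_pderiv i F)) = 0"
      using sing arg_cong[OF line[of "\<lambda>j. B $ j $ a"], of "\<lambda>p. poly (pderiv p) 0"]
      unfolding poly_taylor_1 singular_at_def by simp
    then show ?thesis
      by (simp add: if_distribR if_distrib sum.delta cong: if_cong)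
  qed
  ultimately show ?thesis by (simp add: singular_at_def)
qed

lemma monom_val_eq_0: "i \<in> Poly_Mapping.keys m \<Longrightarrow> x i = 0 \<Longrightarrow> monom_val x m = 0"
  unfolding monom_val_def by (rule prod_zero) (auto intro!: bexI[of _ i] simp: in_keys_iff power_0_left)

text \<open>A form vanishing on a coordinate subspace of dimension \<open>card I\<close> is singular at a common zero
  of its remaining derivatives, which exists when there are fewer than \<open>card I\<close> of them.\<close>

lemma nonsingular_monomials:
  fixes F :: "('n::finite, 'k::alg_closed_field) mpoly"
  assumes F: "F \<in> forms d" "d \<ge> 2" and nonsing: "\<And>x. singular_at x F \<Longrightarrow> x = (\<lambda>_. 0)" and "I \<noteq> {}"
  shows "(\<exists>m\<in>Poly_Mapping.keys F. Poly_Mapping.keys m \<subseteq> I) \<or>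
    card I \<le> card {j. j \<notin> I \<and> (\<exists>m\<in>Poly_Mapping.keys F. Poly_Mapping.lookup m j > 0 \<and>
      Poly_Mapping.keys (m - Poly_Mapping.single j 1) \<subseteq> I)}" (is "_ \<or> card I \<le> card ?J")
proof (rule ccontr)
  assume neg: "\<not> ?thesis"
  then have "card ?J < card I" by simp
  then obtain x where nz: "\<exists>i. x i \<noteq> 0" and out: "\<And>i. i \<notin> I \<Longrightarrow> x i = 0"
    and zero: "\<And>j. j \<in> ?J \<Longrightarrow> mpoly_eval x (mpoly_pderiv j F) = 0"
    using forms_common_zero[of ?J I "d - 1" "\<lambda>j. mpoly_pderiv j F"] F forms_pderiv[OF F(1)] by auto
  have noI: "\<not> Poly_Mapping.keys m \<subseteq> I" if "m \<in> Poly_Mapping.keys F" for m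
    using neg that by blast
  have "mpoly_eval x F = 0"
    unfolding mpoly_eval_eq_hom mpoly_hom_def
  proof (rule sum.neutral, rule ballI)
    fix m assume "m \<in> Poly_Mapping.keys F"
    then obtain i where "i \<in> Poly_Mapping.keys m" "i \<notin> I" using noI by blast
    then show "Poly_Mapping.lookup F m * monom_val x m = 0"
      using monom_val_eq_0[of i m x] out by simp
  qed
  moreover have "mpoly_eval x (mpoly_pderiv i F) = 0" for i
  proof (cases "i \<in> ?J")
    case False
    show ?thesis
      unfolding mpoly_eval_pderiv
    proof (rule sum.neutral, rule ballI)
      fix m assume m: "m \<in> Poly_Mapping.keys F"
      show "of_nat (Poly_Mapping.lookup m i) * Poly_Mapping.lookup F m *
          monom_val x (m - Poly_Mapping.single i 1) = 0"
      proof (cases "Poly_Mapping.lookup m i = 0")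
        case False': False
        \<comment> \<open>Otherwise \<open>i \<notin> I\<close> would put \<open>i\<close> into
          \<open>?J\<close>, and \<open>i \<in> I\<close> would make \<open>m\<close> a monomial in
          the variables of \<open>I\<close> alone.\<close>
        have "\<not> Poly_Mapping.keys (m - Poly_Mapping.single i 1) \<subseteq> I"
        proof
          assume sub: "Poly_Mapping.keys (m - Poly_Mapping.single i 1) \<subseteq> I"
          then have "i \<in> I" using False False' m by blast
          have "j \<in> Poly_Mapping.keys (m - Poly_Mapping.single i 1) \<or> j = i" if "j \<in> Poly_Mapping.keys m" for j
            using that by (auto simp: in_keys_iff lookup_minus lookup_single when_def)
          then have "Poly_Mapping.keys m \<subseteq> I" using sub \<open>i \<in> I\<close> by blast
          with noI[OF m] show False by simp
        qed
        then obtain l where "l \<in> Poly_Mapping.keys (m - Poly_Mapping.single i 1)" "l \<notin> I" by blast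
        then show ?thesis
          using monom_val_eq_0[of l _ x] out by simp
      qed simp
    qed
  qed (rule zero)
  ultimately have "x = (\<lambda>_. 0)" by (intro nonsing) (simp add: singular_at_def)
  with nz show False by simp
qed


subsection \<open>Properness of the action\<close>

context place
begin

text \<open>The polynomials with coefficients in \<open>V\<close> form a subring, which contains the
  linear forms given by \<open>B\<close>.\<close>

lemma V_lin_subst:
  fixes F :: "('n::finite, 'K) mpoly"
  assumes F: "\<And>m. Poly_Mapping.lookup F m \<in> V" and B: "\<And>i j. B $ i $ j \<in> V"
  shows "Poly_Mapping.lookup (lin_subst (\<lambda>c. c) B F) m \<in> V"
proof -
  define C where "C = {p :: ('n, 'K) mpoly. \<forall>m. Poly_Mapping.lookup p m \<in> V}"
  have add: "p + q \<in> C" if "p \<in> C" "q \<in> C" for p q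
    using that by (auto simp: C_def lookup_add V_add)
  have zero: "0 \<in> C" by (simp add: C_def V_0)
  have sum': "sum f A \<in> C" if "\<And>i. i \<in> A \<Longrightarrow> f i \<in> C" for f and A :: "('n \<Rightarrow>\<^sub>0 nat) set"
    using that by (induction A rule: infinite_finite_induct) (auto simp: zero add)
  have single: "Poly_Mapping.single m c \<in> C" if "c \<in> V" for m c
    using that by (auto simp: C_def lookup_single when_def V_0)
  have mult: "p * q \<in> C" if "p \<in> C" "q \<in> C" for p q
  proof -
    have "p * q = (\<Sum>m\<in>Poly_Mapping.keys p. Poly_Mapping.single m (Poly_Mapping.lookup p m)) *
        (\<Sum>m\<in>Poly_Mapping.keys q. Poly_Mapping.single m (Poly_Mapping.lookup q m))"
      by (simp flip: sum_single)
    also have "\<dots> = (\<Sum>m\<in>Poly_Mapping.keys p. \<Sum>m'\<in>Poly_Mapping.keys q.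
        Poly_Mapping.single (m + m') (Poly_Mapping.lookup p m * Poly_Mapping.lookup q m'))"
      by (simp add: sum_product mult_single)
    also have "\<dots> \<in> C"
      using that by (intro sum' single V_mult) (auto simp: C_def)
    finally show ?thesis .
  qed
  have one: "1 \<in> C" using single[OF V_1, of 0] by simp
  have power: "p ^ n \<in> C" if "p \<in> C" for p n
    using that by (induction n) (auto simp: one mult)
  have prod: "prod f A \<in> C" if "\<And>i. i \<in> A \<Longrightarrow> f i \<in> C" for f and A :: "'n set"
    using that by (induction A rule: infinite_finite_induct) (auto simp: one mult)
  have sum_n: "sum f A \<in> C" if "\<And>i. i \<in> A \<Longrightarrow> f i \<in> C" for f and A :: "'n set"
    using that by (induction A rule: infinite_finite_induct) (auto simp: zero add)
  have "linear_forms B i \<in> C" for i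
    unfolding linear_forms_def mpoly_const_def mpoly_var_def
    by (intro sum_n mult single B V_1)
  then have "lin_subst (\<lambda>c. c) B F \<in> C"
    unfolding lin_subst_def mpoly_hom_def monom_val_def mpoly_const_def
    by (intro sum' mult single F prod power)
  then show ?thesis by (simp add: C_def)
qed

end

text \<open>Diagonal substitutions scale each monomial by its weight, so integrality of the result
  can be tested monomial by monomial.\<close>

lemma lookup_lin_subst_diagonal:
  fixes H :: "('n::finite, 'a::field) mpoly"
  shows "Poly_Mapping.lookup (lin_subst (\<lambda>c. c) (\<chi> i j. if i = j then D i else 0) H) m =
    Poly_Mapping.lookup H m * monom_val D m"
proof -
  interpret k: unital_hom "mpoly_const :: 'a \<Rightarrow> ('n, 'a) mpoly"
    by (rule mpoly_const_hom)
  have lin: "linear_forms (\<chi> i j. if i = j then D i else 0) = (\<lambda>i. mpoly_const (D i) * mpoly_var i)"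
  proof
    fix i
    have "linear_forms (\<chi> i j. if i = j then D i else 0) i =
        (\<Sum>j\<in>UNIV. if i = j then mpoly_const (D j) * mpoly_var j else 0)"
      unfolding linear_forms_def by (intro sum.cong refl) (simp add: k.hom_zero)
    then show "linear_forms (\<chi> i j. if i = j then D i else 0) i = mpoly_const (D i) * mpoly_var i"
      by simp
  qed
  have "monom_val (\<lambda>i. mpoly_const (D i) * mpoly_var i) m =
      mpoly_const (monom_val D m) * monom_val mpoly_var m" for m
    by (simp add: monom_val_def power_mult_distrib prod.distrib k.hom_prod k.hom_power)
  then have "lin_subst (\<lambda>c. c) (\<chi> i j. if i = j then D i else 0) H =
      (\<Sum>m\<in>Poly_Mapping.keys H. mpoly_const (Poly_Mapping.lookup H m * monom_val D m) * monom_val mpoly_var m)"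
    unfolding lin_subst_def lin mpoly_hom_def by (simp add: k.hom_mult mult.assoc)
  also have "\<dots> = mpoly_hom mpoly_const mpoly_var
      (\<Sum>m\<in>Poly_Mapping.keys H. Poly_Mapping.single m (Poly_Mapping.lookup H m * monom_val D m))"
    by (simp add: k.mpoly_hom_sum k.mpoly_hom_single)
  finally show ?thesis
    by (simp add: unital_hom.mpoly_hom_map_coeffs[OF unital_hom_id] lookup_sum lookup_single when_def in_keys_iff)
qed

text \<open>The valuative criterion of properness for the map \<open>A \<mapsto> F \<circ> A\<close> on \<open>SL\<close>.\<close>

theorem entries_integral:
  fixes \<iota> :: "'k::alg_closed_field \<Rightarrow> 'K::field" and F :: "('n::finite, 'k) mpoly" and A :: "'K ^ 'n ^ 'n"
  assumes "place \<iota> V g" and F: "F \<in> forms d" "d \<ge> 3"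
    and nonsing: "\<And>x. singular_at x F \<Longrightarrow> x = (\<lambda>_. 0)"
    and det: "det A = 1" and coeffs: "\<And>m. Poly_Mapping.lookup (lin_subst \<iota> A F) m \<in> V"
  shows "A $ i $ j \<in> V"
proof -
  interpret place \<iota> V g by (rule assms(1))
  interpret K: unital_hom "\<lambda>c::'K. c" by (rule unital_hom_id)
  interpret k: unital_hom "\<lambda>c::'k. c" by (rule unital_hom_id)
  obtain P Q D where PQ: "V_invertible P" "V_invertible Q"
    and A: "A = P ** (\<chi> i j. if i = j then D i else 0) ** Q" (is "_ = P ** ?D ** Q")
    by (rule smith_decomposition)
  obtain P' where P': "V_invertible P'" "P ** P' = mat 1" "P' ** P = mat 1"
    by (rule V_invertible_inverse[OF PQ(1)])
  obtain Q' where Q': "V_invertible Q'" "Q ** Q' = mat 1"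
    using V_invertible_inverse[OF PQ(2)] by metis
  have entries: "M $ i $ j \<in> V" if "V_invertible M" for M :: "'K ^ 'n ^ 'n" and i j
    using that by (simp add: V_invertible_def)
  define H where "H = lin_subst \<iota> P F"
  define P0 where "P0 = (\<chi> i j. g (P $ i $ j))"
  define P0' where "P0' = (\<chi> i j. g (P' $ i $ j))"
  define h where "h = lin_subst (\<lambda>c. c) P0 F"
  have inv: "(\<chi> i j. g (M $ i $ j)) ** (\<chi> i j. g (N $ i $ j)) = mat 1"
    if MN: "V_invertible M" "V_invertible N" "M ** N = mat 1" for M N :: "'K ^ 'n ^ 'n"
  proof -
    have "((\<chi> i j. g (M $ i $ j)) ** (\<chi> i j. g (N $ i $ j))) $ i $ j = g ((M ** N) $ i $ j)" for i j
      using MN(1,2) by (simp add: matrix_matrix_mult_def g_sum g_mult V_mult entries)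
    then show ?thesis
      unfolding MN(3) by (simp add: vec_eq_iff mat_def g_0 g_1)
  qed
  have P0: "P0 ** P0' = mat 1" "P0' ** P0 = mat 1"
    unfolding P0_def P0'_def by (intro inv PQ P')+
  have reduce: "Poly_Mapping.lookup H m \<in> V" "g (Poly_Mapping.lookup H m) = Poly_Mapping.lookup h m" for m
    unfolding H_def h_def \<iota>.lookup_lin_subst k.lookup_lin_subst
    by (auto simp: mpoly_hom_V g_mpoly_hom entries[OF PQ(1)] mpoly_eval_eq_hom P0_def case_prod_beta')
  \<comment> \<open>The reduction \<open>P0\<close> is invertible over \<open>k\<close>, and a
    singular point of \<open>F \<circ> P0\<close> is mapped by it to one of
    \<open>F\<close>.\<close>
  have nonsing_h: "x = (\<lambda>_. 0)" if "singular_at x h" for x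
  proof -
    have "(\<lambda>i. \<Sum>j\<in>UNIV. P0 $ i $ j * x j) = (\<lambda>_. 0)"
      using that P0(1) unfolding h_def by (intro nonsing singular_at_lin_subst)
    then have "P0 *v (\<chi> i. x i) = 0"
      by (simp add: matrix_vector_mult_def vec_eq_iff fun_eq_iff)
    then have "P0' *v (P0 *v (\<chi> i. x i)) = 0" by simp
    then have "(\<chi> i. x i) = 0"
      by (simp add: matrix_vector_mul_assoc P0(2))
    then show ?thesis by (simp add: vec_eq_iff fun_eq_iff)
  qed
  have h: "h \<in> forms d" unfolding h_def by (rule forms_lin_subst[OF F(1)])
  \<comment> \<open>Composing with the integral matrix \<open>Q'\<close> keeps the coefficients
    integral and removes \<open>Q\<close>, leaving \<open>F \<circ> P D\<close>.\<close>
  have AQ': "A ** Q' = P ** ?D"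
    unfolding A by (simp add: Q'(2) flip: matrix_mul_assoc)
  have "lin_subst (\<lambda>c. c) ?D H = lin_subst (\<lambda>c. c) Q' (lin_subst \<iota> A F)"
    unfolding H_def K.lin_subst_lin_subst by (simp add: AQ')
  then have weight: "Poly_Mapping.lookup H m * monom_val D m \<in> V" for m
    using V_lin_subst[OF coeffs entries[OF Q'(1)], of m]
    by (simp flip: lookup_lin_subst_diagonal)
  have det_unit: "det M \<in> V" if "V_invertible M" for M :: "'K ^ 'n ^ 'n"
    using that by (intro g_det entries)
  have detP: "det P * det P' = 1" and detQ: "det Q * det Q' = 1"
    using P'(2) Q'(2) by (simp_all flip: det_mul)
  have detD: "det P * (\<Prod>i\<in>UNIV. D i) * det Q = 1"
    using det unfolding A det_mul by (subst (asm) det_diagonal) auto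
  have prodD: "(\<Prod>i\<in>UNIV. D i) = det P' * det Q'" "inverse (\<Prod>i\<in>UNIV. D i) = det P * det Q"
  proof -
    have "(\<Prod>i\<in>UNIV. D i) = (det P * det P') * (\<Prod>i\<in>UNIV. D i) * (det Q * det Q')"
      by (simp add: detP detQ)
    also have "\<dots> = (det P * (\<Prod>i\<in>UNIV. D i) * det Q) * (det P' * det Q')"
      by (simp only: mult_ac)
    finally show "(\<Prod>i\<in>UNIV. D i) = det P' * det Q'" by (simp add: detD)
    show "inverse (\<Prod>i\<in>UNIV. D i) = det P * det Q"
      using detD by (intro inverse_unique) (simp add: mult_ac)
  qed
  have "D i \<in> V" for i
  proof (rule weights_trivial[of D d "Poly_Mapping.keys h"])
    have "(\<Prod>i\<in>UNIV. D i) \<noteq> 0"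
      using detD by (metis mult_zero_left mult_zero_right zero_neq_one)
    then show "D i \<noteq> 0" for i by simp
    show "monom_val D m \<in> V" if "m \<in> Poly_Mapping.keys h" for m
    proof -
      \<comment> \<open>A monomial surviving in the reduction \<open>h\<close> has a unit of
        \<open>V\<close> as its coefficient in \<open>H\<close>; dividing by it leaves the bare
        weight.\<close>
      have nz: "g (Poly_Mapping.lookup H m) \<noteq> 0"
        using that by (simp add: reduce in_keys_iff)
      then have "Poly_Mapping.lookup H m \<noteq> 0" using g_0 by metis
      then have "monom_val D m = inverse (Poly_Mapping.lookup H m) * (Poly_Mapping.lookup H m * monom_val D m)"
        by simp
      with V_mult[OF V_inverse_unit[OF nz] weight] show ?thesis by metis
    qed
    show "inverse (\<Prod>i\<in>UNIV. D i) \<in> V"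
      unfolding prodD(2) by (intro V_mult det_unit PQ)
    show "(\<Prod>i\<in>UNIV. D i) \<in> V"
      unfolding prodD(1) by (intro V_mult det_unit P' Q')
    show "(\<Sum>i\<in>UNIV. Poly_Mapping.lookup m i) = d" if "m \<in> Poly_Mapping.keys h" for m
      using h that by (simp add: forms_def)
    show "(\<exists>m\<in>Poly_Mapping.keys h. Poly_Mapping.keys m \<subseteq> I) \<or>
        card I \<le> card {j. j \<notin> I \<and> (\<exists>m\<in>Poly_Mapping.keys h. Poly_Mapping.lookup m j > 0 \<and>
          Poly_Mapping.keys (m - Poly_Mapping.single j 1) \<subseteq> I)}" if "I \<noteq> {}" for I
      using F(2) by (intro nonsingular_monomials[OF h _ nonsing_h that]) auto
  qed (rule F(2))
  then have DV: "?D $ i $ j \<in> V" for i j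
    by (simp add: V_0)
  show ?thesis
    unfolding A by (intro V_matrix_mult DV entries[OF PQ(1)] entries[OF PQ(2)])
qed

section \<open>Matrices over the ultrapower and the orbit map\<close>

lemma lookup_lin_subst_hyper:
  fixes s :: "'x set set \<Rightarrow> 'k::field ^ 'n ^ 'n"
  shows "Poly_Mapping.lookup (lin_subst (\<lambda>c. abs_hyper (\<lambda>_. c) :: ('x, 'k) hyper)
      (\<chi> a b. abs_hyper (\<lambda>i. s i $ a $ b)) F) m =
    abs_hyper (\<lambda>i. Poly_Mapping.lookup (lin_subst (\<lambda>c. c) (s i) F) m)"
proof -
  interpret h: unital_hom "\<lambda>c. abs_hyper (\<lambda>_. c) :: ('x, 'k) hyper"
    by (rule unital_hom_abs_hyper_const)
  interpret k: unital_hom "\<lambda>c::'k. c" by (rule unital_hom_id)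
  have "mpoly_eval (\<lambda>v. case v of (a, b) \<Rightarrow> s i $ a $ b) (universal_coeff F m) =
      Poly_Mapping.lookup (lin_subst (\<lambda>c. c) (s i) F) m" for i
    by (simp add: k.lookup_lin_subst mpoly_eval_eq_hom)
  then show ?thesis
    unfolding h.lookup_lin_subst
    using abs_hyper_mpoly_eval[where x = "\<lambda>v i. case v of (a, b) \<Rightarrow> s i $ a $ b" and P = "universal_coeff F m"]
    by (simp add: case_prod_beta')
qed

lemma matrix_inv_left_right:
  fixes A :: "'k::field ^ 'n ^ 'n"
  assumes "invertible A"
  shows "A ** matrix_inv A = mat 1" "matrix_inv A ** A = mat 1"
  using someI_ex[OF assms[unfolded invertible_def]] unfolding matrix_inv_def by blast+

lemma matrix_inv_SL:
  fixes A :: "'k::field ^ 'n ^ 'n"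
  assumes "det A = 1"
  shows "det (matrix_inv A) = 1" "matrix_inv (matrix_inv A) = A"
proof -
  have "invertible A" using assms by (simp add: invertible_det_nz)
  then have inv: "A ** matrix_inv A = mat 1" "matrix_inv A ** A = mat 1"
    by (simp_all add: matrix_inv_left_right)
  have "det A * det (matrix_inv A) = 1"
    using inv by (simp flip: det_mul)
  then show "det (matrix_inv A) = 1" using assms by simp
  then have "invertible (matrix_inv A)" by (simp add: invertible_det_nz)
  then have "matrix_inv A ** matrix_inv (matrix_inv A) = mat 1"
    by (simp add: matrix_inv_left_right)
  then have "A ** (matrix_inv A ** matrix_inv (matrix_inv A)) = A" by simp
  then show "matrix_inv (matrix_inv A) = A"
    by (simp add: matrix_mul_assoc inv)
qed

text \<open>Inversion permutes \<open>SL\<close>, so the inverse in the action can be absorbed into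
  the parameter.\<close>

lemma SL_orbit_eq: "SL_orbit F = {lin_subst (\<lambda>c. c) B F | B. det B = 1}"
proof -
  have "lin_subst (\<lambda>c. c) B F \<in> SL_orbit F" if "det B = 1" for B
    using matrix_inv_SL[OF that] unfolding SL_orbit_def special_linear_def
    by (intro image_eqI[of _ _ "matrix_inv B"]) (auto simp: matrix_act_eq)
  then show ?thesis
    using matrix_inv_SL by (auto simp: SL_orbit_def special_linear_def matrix_act_eq)
qed

theorem finite_SL_stabilizer:
  fixes F :: "('n::finite, 'k::alg_closed_field) mpoly"
  assumes F: "F \<in> forms d" "d \<ge> 3" and nonsing: "\<And>x. singular_at x F \<Longrightarrow> x = (\<lambda>_. 0)"
  shows "finite (SL_stabilizer F)"
proof -
  define S where "S = {B :: 'k ^ 'n ^ 'n. det B = 1 \<and> lin_subst (\<lambda>c. c) B F = F}"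
  \<comment> \<open>It suffices to bound the values of each single entry, as a matrix is determined
    by finitely many entries.\<close>
  have "finite ((\<lambda>B. B $ a $ b) ` S)" for a b
  proof (rule ccontr)
    assume inf: "infinite ((\<lambda>B. B $ a $ b) ` S)"
    \<comment> \<open>Each condition excludes one constant as the value of the entry. Infinitely
      many values satisfy any finite number of these conditions, so saturation gives an entry that
      is no constant at all.\<close>
    define E where "E c = {B \<in> S. B $ a $ b \<noteq> c}" for c
    have fip: "\<Inter>\<D> \<noteq> {}" if "finite \<D>" "\<D> \<subseteq> range E" for \<D>
    proof -
      from that obtain C where C: "finite C" "\<D> = E ` C"
        by (metis finite_subset_image)
      have "\<exists>y\<in>(\<lambda>B. B $ a $ b) ` S. y \<notin> C"
        using inf C(1) by (meson finite_subset subsetI)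
      then show ?thesis using C(2) by (auto simp: E_def)
    qed
    obtain s :: "('k ^ 'n ^ 'n) set set \<Rightarrow> 'k ^ 'n ^ 'n" where
      s: "\<And>X. X \<in> range E \<Longrightarrow> eventually (\<lambda>i. s i \<in> X) saturating_ultrafilter"
      using saturation[OF fip] by blast
    define \<iota> where "\<iota> = (\<lambda>c. abs_hyper (\<lambda>_. c) :: ('k ^ 'n ^ 'n, 'k) hyper)"
    define B where "B = (\<chi> a b. (abs_hyper (\<lambda>i. s i $ a $ b) :: ('k ^ 'n ^ 'n, 'k) hyper))"
    interpret \<iota>: unital_hom \<iota> unfolding \<iota>_def by (rule unital_hom_abs_hyper_const)
    have sS: "eventually (\<lambda>i. s i \<in> S) saturating_ultrafilter"
      by (rule eventually_mono[OF s[of "E 0"]]) (auto simp: E_def)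
    have "abs_hyper (\<lambda>i. det (s i)) = (1 :: ('k ^ 'n ^ 'n, 'k) hyper)"
      unfolding abs_hyper_hom(2)[symmetric] abs_hyper_eq_iff
      by (rule eventually_mono[OF sS]) (auto simp: S_def)
    then have detB: "det B = 1" by (simp add: abs_hyper_det B_def)
    have coeffs: "Poly_Mapping.lookup (lin_subst \<iota> B F) m = \<iota> (Poly_Mapping.lookup F m)" for m
      unfolding \<iota>_def B_def lookup_lin_subst_hyper abs_hyper_eq_iff
      by (rule eventually_mono[OF sS]) (auto simp: S_def)
    define y where "y = B $ a $ b"
    have y: "y \<noteq> \<iota> c" for c
    proof
      assume "y = \<iota> c"
      then have "eventually (\<lambda>i. s i $ a $ b = c) saturating_ultrafilter"
        by (simp add: y_def B_def \<iota>_def abs_hyper_eq_iff)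
      moreover have "eventually (\<lambda>i. s i \<in> E c) saturating_ultrafilter"
        by (rule s) auto
      ultimately have "eventually (\<lambda>_::('k ^ 'n ^ 'n) set set. False) saturating_ultrafilter"
        by eventually_elim (auto simp: E_def)
      then show False using saturating_ultrafilter(2)[where 'x = "'k ^ 'n ^ 'n"] by (simp add: trivial_limit_def)
    qed
    have "y \<noteq> 0" using y[of 0] by (simp add: \<iota>.hom_zero)
    have "inverse y \<notin> range \<iota>"
    proof
      assume "inverse y \<in> range \<iota>"
      then obtain c where c: "inverse y = \<iota> c" by auto
      with \<open>y \<noteq> 0\<close> have "c \<noteq> 0" using \<iota>.hom_zero by auto
      then have "\<iota> c * \<iota> (inverse c) = 1" by (simp add: \<iota>.hom_one flip: \<iota>.hom_mult)
      then have "y = \<iota> (inverse c)"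
        using c \<open>y \<noteq> 0\<close> by (metis inverse_inverse_eq inverse_unique)
      with y show False by blast
    qed
    then obtain V g where Vg: "place \<iota> V g" "inverse y \<in> V" "g (inverse y) = 0"
      by (rule place_at_transcendental[OF \<iota>.unital_hom_axioms])
    then interpret place \<iota> V g by simp
    \<comment> \<open>The matrix fixes \<open>F\<close>, so the coefficients of
      \<open>F \<circ> B\<close> are constants and integral at every place.\<close>
    have "y \<in> V"
      unfolding y_def by (rule entries_integral[OF Vg(1) F nonsing detB]) (auto simp: coeffs const_V)
    then have "g (y * inverse y) = 0" using Vg by (simp add: g_mult)
    with \<open>y \<noteq> 0\<close> show False by (simp add: g_1)
  qed
  then have "finite (PiE UNIV (\<lambda>(a, b). (\<lambda>B. B $ a $ b) ` S))"
    by (intro finite_PiE) auto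
  moreover have "(\<lambda>B (a, b). B $ a $ b) ` S \<subseteq> PiE UNIV (\<lambda>(a, b). (\<lambda>B. B $ a $ b) ` S)"
    by auto
  ultimately have "finite ((\<lambda>B (a, b). B $ a $ b) ` S)"
    by (rule finite_subset[rotated])
  moreover have "inj_on (\<lambda>B (a, b). B $ a $ b) S"
    by (rule inj_onI) (auto simp: vec_eq_iff fun_eq_iff)
  ultimately have "finite S" by (rule finite_imageD)
  moreover have "matrix_inv ` SL_stabilizer F \<subseteq> S"
    using matrix_inv_SL by (auto simp: SL_stabilizer_def special_linear_def matrix_act_eq S_def)
  ultimately have "finite (matrix_inv ` SL_stabilizer F)"
    by (rule finite_subset[rotated])
  moreover have "inj_on matrix_inv (SL_stabilizer F)"
    by (rule inj_on_inverseI[of _ matrix_inv]) (auto simp: SL_stabilizer_def special_linear_def matrix_inv_SL)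
  ultimately show ?thesis by (rule finite_imageD)
qed

theorem zariski_closed_SL_orbit:
  fixes F :: "('n::finite, 'k::alg_closed_field) mpoly"
  assumes F: "F \<in> forms d" "d \<ge> 3" and nonsing: "\<And>x. singular_at x F \<Longrightarrow> x = (\<lambda>_. 0)"
  shows "zariski_closed_in_forms d (SL_orbit F)"
proof -
  interpret k: unital_hom "\<lambda>c::'k. c" by (rule unital_hom_id)
  define act where "act B = lin_subst (\<lambda>c. c) B F" for B
  \<comment> \<open>The equations are all polynomials vanishing on the orbit.\<close>
  define S where "S = {P. \<forall>B. det B = 1 \<longrightarrow> mpoly_eval (Poly_Mapping.lookup (act B)) P = 0}"
  have "G \<in> SL_orbit F" if G: "\<And>P. P \<in> S \<Longrightarrow> mpoly_eval (Poly_Mapping.lookup G) P = 0" for G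
  proof -
    define E where "E P = {B. det B = 1 \<and> mpoly_eval (Poly_Mapping.lookup (act B)) P \<noteq> 0}" for P
    define N where "N = {P. mpoly_eval (Poly_Mapping.lookup G) P \<noteq> 0}"
    have fip: "\<Inter>\<D> \<noteq> {}" if "finite \<D>" "\<D> \<subseteq> E ` N" for \<D>
    proof -
      from that obtain C where C: "finite C" "C \<subseteq> N" "\<D> = E ` C"
        by (metis finite_subset_image)
      have prod: "mpoly_eval x (\<Prod>P\<in>C. P) = (\<Prod>P\<in>C. mpoly_eval x P)" for x :: "('n \<Rightarrow>\<^sub>0 nat) \<Rightarrow> 'k"
        unfolding mpoly_eval_eq_hom by (rule unital_hom.hom_prod[OF k.unital_hom_mpoly_hom])
      \<comment> \<open>A product of polynomials not vanishing at \<open>G\<close> does not vanish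
        at \<open>G\<close>, hence not on the whole orbit: a single matrix serves for all
        factors.\<close>
      have "mpoly_eval (Poly_Mapping.lookup G) (\<Prod>P\<in>C. P) \<noteq> 0"
        using C by (auto simp: prod N_def)
      then obtain B where "det B = 1" "mpoly_eval (Poly_Mapping.lookup (act B)) (\<Prod>P\<in>C. P) \<noteq> 0"
        using G by (auto simp: S_def)
      then have "B \<in> \<Inter>\<D>" using C by (auto simp: prod E_def)
      then show ?thesis by blast
    qed
    obtain s :: "('k ^ 'n ^ 'n) set set \<Rightarrow> 'k ^ 'n ^ 'n" where
      s: "\<And>X. X \<in> E ` N \<Longrightarrow> eventually (\<lambda>i. s i \<in> X) saturating_ultrafilter"
      using saturation[OF fip] by blast
    define \<iota> where "\<iota> = (\<lambda>c. abs_hyper (\<lambda>_. c) :: ('k ^ 'n ^ 'n, 'k) hyper)"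
    define B where "B = (\<chi> a b. (abs_hyper (\<lambda>i. s i $ a $ b) :: ('k ^ 'n ^ 'n, 'k) hyper))"
    have hom: "unital_hom \<iota>" unfolding \<iota>_def by (rule unital_hom_abs_hyper_const)
    \<comment> \<open>The condition \<open>E 1\<close> is membership in \<open>SL\<close>; realizing
      it gives the generic matrix determinant 1.\<close>
    have "1 \<in> N"
      by (simp add: N_def mpoly_eval_eq_hom unital_hom.hom_one[OF k.unital_hom_mpoly_hom])
    then have "eventually (\<lambda>i. s i \<in> E 1) saturating_ultrafilter" by (intro s) auto
    then have "abs_hyper (\<lambda>i. det (s i)) = (1 :: ('k ^ 'n ^ 'n, 'k) hyper)"
      unfolding abs_hyper_hom(2)[symmetric] abs_hyper_eq_iff
      by (rule eventually_mono) (auto simp: E_def)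
    then have detB: "det B = 1" by (simp add: abs_hyper_det B_def)
    define z where "z = Poly_Mapping.lookup (lin_subst \<iota> B F)"
    have z: "z = (\<lambda>m. abs_hyper (\<lambda>i. Poly_Mapping.lookup (act (s i)) m))"
      by (rule ext) (simp add: z_def \<iota>_def B_def lookup_lin_subst_hyper act_def)
    \<comment> \<open>The generic orbit point \<open>z\<close> satisfies only equations that hold at
      \<open>G\<close>, so it specializes to \<open>G\<close>.\<close>
    have "mpoly_eval (Poly_Mapping.lookup G) P = 0" if "mpoly_hom \<iota> z P = 0" for P
    proof (rule ccontr)
      assume "mpoly_eval (Poly_Mapping.lookup G) P \<noteq> 0"
      then have 1: "eventually (\<lambda>i. s i \<in> E P) saturating_ultrafilter"
        by (intro s) (auto simp: N_def)
      have "abs_hyper (\<lambda>i. mpoly_eval (Poly_Mapping.lookup (act (s i))) P) = (0 :: ('k ^ 'n ^ 'n, 'k) hyper)"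
        using that abs_hyper_mpoly_eval[where x = "\<lambda>m i. Poly_Mapping.lookup (act (s i)) m" and P = P]
        by (simp add: z \<iota>_def)
      then have "eventually (\<lambda>i. mpoly_eval (Poly_Mapping.lookup (act (s i))) P = 0) saturating_ultrafilter"
        unfolding abs_hyper_hom(1)[symmetric] abs_hyper_eq_iff .
      with 1 have "eventually (\<lambda>_::('k ^ 'n ^ 'n) set set. False) saturating_ultrafilter"
        by eventually_elim (auto simp: E_def)
      then show False using saturating_ultrafilter(2)[where 'x = "'k ^ 'n ^ 'n"] by (simp add: trivial_limit_def)
    qed
    then obtain V g where Vg: "place \<iota> V g" "\<And>m. z m \<in> V \<and> g (z m) = Poly_Mapping.lookup G m"
      by (rule place_specializing[OF hom]) auto
    then interpret place \<iota> V g by simp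
    have BV: "B $ a $ b \<in> V" for a b
      by (rule entries_integral[OF Vg(1) F nonsing detB]) (use Vg(2) in \<open>auto simp: z_def\<close>)
    \<comment> \<open>Determinant and coefficients are polynomial in the entries, so the residues of
      the integral matrix \<open>B\<close> form a matrix of \<open>SL\<close> carrying
      \<open>F\<close> to \<open>G\<close>.\<close>
    define B0 where "B0 = (\<chi> a b. g (B $ a $ b))"
    have "det B0 = 1"
      using g_det(2)[of B] BV detB by (simp add: B0_def g_1)
    moreover have "act B0 = G"
    proof (rule poly_mapping_eqI)
      fix m
      have "Poly_Mapping.lookup (act B0) m = g (z m)"
        unfolding act_def z_def k.lookup_lin_subst \<iota>.lookup_lin_subst
        by (subst g_mpoly_hom) (auto simp: BV B0_def mpoly_eval_eq_hom case_prod_beta')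
      then show "Poly_Mapping.lookup (act B0) m = Poly_Mapping.lookup G m"
        using Vg(2) by simp
    qed
    ultimately show ?thesis
      unfolding SL_orbit_eq act_def by blast
  qed
  moreover have "SL_orbit F \<subseteq> forms d"
    using forms_lin_subst[OF F(1)] by (auto simp: SL_orbit_eq)
  moreover have "mpoly_eval (Poly_Mapping.lookup G) P = 0" if "P \<in> S" "G \<in> SL_orbit F" for P G
    using that by (auto simp: SL_orbit_eq S_def act_def)
  ultimately show ?thesis
    unfolding zariski_closed_in_forms_def by (intro exI[of _ S]) blast
qed

theorem theorem1p1:
  fixes F :: "('n::finite, 'k::alg_closed_field) mpoly"
    and n d :: nat
  assumes "CARD('n) = n + 1"
    and "n \<ge> 1"
    and "d \<ge> 3"
    and "F \<in> forms d"
    and "F \<noteq> 0"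
    and "nonsingular_hypersurface F"
  shows "chow_stable d F"
proof -
  have "x = (\<lambda>_. 0)" if "singular_at x F" for x
  proof -
    have "($) (\<chi> i. x i) = x" by (rule ext) simp
    with that assms(6) have "(\<chi> i. x i) = (0 :: 'k ^ 'n)"
      unfolding nonsingular_hypersurface_def singular_at_def by metis
    then show ?thesis by (simp add: vec_eq_iff fun_eq_iff)
  qed
  then show ?thesis
    using assms(3,4) by (simp add: chow_stable_def zariski_closed_SL_orbit finite_SL_stabilizer)
qed

end
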